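(* Let $n\ge2$ and $s\in\left(\frac{n-1}{2},n-1\right)$. Then there exists an open set $\Omega\subset\mathbb{H}^n$ whose asymptotic boundary $\partial_\infty\Omega$ has Hausdorff dimension $s$ and which admits a bounded $\lambda_1$-harmonic function, i.e. a nontrivial bounded $u\in C(\overline\Omega)\cap C^2(\Omega)$ with $-\Delta u=\frac{(n-1)^2}{4}u$ in $\Omega$ and $u=0$ on $\partial\Omega$.
   Context: $\mathbb{H}^n$ is hyperbolic space with Laplace–Beltrami operator $\Delta$. $\partial_\infty\mathbb{H}^n$ is the set of classes of geodesic rays at bounded distance, with the cone topology; $\partial_\infty\Omega$ is the boundary of $\Omega$ in $\mathbb{H}^n\cup\partial_\infty\mathbb{H}^n$ minus its boundary in $\mathbb{H}^n$. The Hausdorff dimension of a subset of $\partial_\infty\mathbb{H}^n$ is that of its image on the unit sphere $\partial B\subset\mathbb{R}^n$ under the identification given by a Poincaré ball model (independent of the model). *)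

theory Defs
  imports "HOL-Analysis.Analysis"
begin

definition hd_term :: "real \<Rightarrow> 'a::metric_space set \<Rightarrow> ennreal" where
  "hd_term s C = (if C = {} then 0 else if s = 0 then 1 else ennreal (diameter C powr s))"

definition hausdorff_pre :: "real \<Rightarrow> real \<Rightarrow> 'a::metric_space set \<Rightarrow> ennreal" where
  "hausdorff_pre s \<delta> A =
     (INF C \<in> {C :: nat \<Rightarrow> 'a set. A \<subseteq> (\<Union>i. C i) \<and> (\<forall>i. bounded (C i) \<and> diameter (C i) \<le> \<delta>)}.
        (\<Sum>i. hd_term s (C i)))"

definition hausdorff_measure :: "real \<Rightarrow> 'a::metric_space set \<Rightarrow> ennreal" where
  "hausdorff_measure s A = (SUP \<delta> \<in> {0<..}. hausdorff_pre s \<delta> A)"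

definition hausdorff_dim :: "'a::metric_space set \<Rightarrow> real" where
  "hausdorff_dim A = Inf {s. 0 \<le> s \<and> hausdorff_measure s A = 0}"

text \<open>H^n is modelled as the open unit ball of R^n = real^'n with metric 4|dx|^2/(1-|x|^2)^2.\<close>
abbreviation hyp_space :: "(real^'n) set" where
  "hyp_space \<equiv> ball 0 1"

definition partial_deriv :: "(real^'n \<Rightarrow> real) \<Rightarrow> real^'n \<Rightarrow> real^'n \<Rightarrow> real" where
  "partial_deriv u v x = frechet_derivative u (at x) v"

definition C2_on :: "(real^'n) set \<Rightarrow> (real^'n \<Rightarrow> real) \<Rightarrow> bool" where
  "C2_on \<Omega> u \<longleftrightarrow> u differentiable_on \<Omega> \<and>
     (\<forall>i\<in>Basis. (\<lambda>x. partial_deriv u i x) differentiable_on \<Omega>) \<and>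
     (\<forall>i\<in>Basis. \<forall>j\<in>Basis. continuous_on \<Omega> (\<lambda>x. partial_deriv (\<lambda>y. partial_deriv u i y) j x))"

definition eucl_laplacian :: "(real^'n \<Rightarrow> real) \<Rightarrow> real^'n \<Rightarrow> real" where
  "eucl_laplacian u x = (\<Sum>i\<in>Basis. partial_deriv (\<lambda>y. partial_deriv u i y) i x)"

text \<open>Laplace-Beltrami operator of the Poincare ball model:
  Delta u = ((1-|x|^2)/2)^2 Delta_E u + (n-2) ((1-|x|^2)/2) (x . grad u).\<close>
definition hyp_laplacian :: "(real^'n \<Rightarrow> real) \<Rightarrow> real^'n \<Rightarrow> real" where
  "hyp_laplacian u x =
     ((1 - (norm x)\<^sup>2) / 2)\<^sup>2 * eucl_laplacian u x
     + (real CARD('n) - 2) * ((1 - (norm x)\<^sup>2) / 2) * partial_deriv u x x"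

text \<open>Asymptotic boundary: the cone topology on H^n \<union> \<partial>H^n is the Euclidean topology
  of the closed unit ball, so \<partial>_\<infinity>\<Omega> = (Euclidean closure of \<Omega>) \<inter> unit sphere.\<close>
definition asymp_boundary :: "(real^'n) set \<Rightarrow> (real^'n) set" where
  "asymp_boundary \<Omega> = closure \<Omega> \<inter> sphere 0 1"

end

(*
  Let \<alpha> = (n-1)/2. Every power exp (\<alpha> L) of the Poisson kernel exp L with a pole on the sphere
  solves the equation, and so does exp (\<alpha> L) (A - L), because \<alpha> is a double root of the indicial
  equation t (n - 1 - t) = (n-1)^2/4. Integrating exp (\<alpha> L) over the poles against a measure \<mu> with
  \<mu> (ball of radius r) comparable to r^s gives a positive solution v. At distance d from the sphere
  it behaves like d^(s-\<alpha>) over the support K of \<mu>, so it is bounded, and it is O(d^\<alpha>) away from K.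
  The solution w = exp (\<alpha> L) (A - L) with a single pole e outside K behaves like d^\<alpha> ln (1/d).
  As \<alpha> < s < 2 \<alpha>, v dominates w exactly near K, and u = v - w vanishes on the boundary of
  {L < 0, v > w}; if A exceeds sup v, the horosphere L = 0 contributes no boundary points.
  For K one takes a self-similar Cantor set of dimension s.
*)
theory Submission
  imports Defs "HOL-Real_Asymp.Real_Asymp"
begin

text \<open>The cut L < 0 answers the sign change of w. Inside the horoball L > A the factor A - L
  is negative, so v > w holds there trivially; e would become an asymptotic boundary point and v - w
  would be unbounded. On L < 0 one has w > 0, hence 0 < u \<le> v on the region. The logarithm
  decides the comparison away from K: a pure power exp (\<alpha> L) has the same order d^\<alpha> as
  v, so the outcome would depend on constants. At e itself the logarithm may stay bounded, and the
  growth of |x - e|^(-2 \<alpha>) takes over. The upper density of \<mu> is used at all points and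
  radii, but a lower density on a dense set of points and for arbitrarily small radii is enough,
  because the asymptotic boundary is closed. This permits a discontinuous increasing parametrisation
  of the Cantor set: \<mu> is an image of Lebesgue measure, and K is the closure of the parametrised
  set. The Hoelder continuity of the inverse then yields both the upper density and the lower bound
  for the Hausdorff dimension.\<close>

section \<open>Functions with continuous second derivatives\<close>

text \<open>\<open>G\<close> is the gradient of \<open>u\<close> and \<open>H i\<close> is the gradient of the \<open>i\<close>-th component of \<open>G\<close>.\<close>

definition C2_jet ::
  "'a::euclidean_space set \<Rightarrow> ('a \<Rightarrow> real) \<Rightarrow> ('a \<Rightarrow> 'a) \<Rightarrow> ('a \<Rightarrow> 'a \<Rightarrow> 'a) \<Rightarrow> bool" where
  "C2_jet U u G H \<longleftrightarrow>
     (\<forall>x\<in>U. (u has_derivative (\<lambda>v. G x \<bullet> v)) (at x)) \<and>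
     (\<forall>i\<in>Basis. \<forall>x\<in>U. ((\<lambda>y. G y \<bullet> i) has_derivative (\<lambda>v. H i x \<bullet> v)) (at x)) \<and>
     (\<forall>i\<in>Basis. continuous_on U (H i))"

lemma C2_jet_diff:
  assumes "C2_jet U u G H" "C2_jet U w G' H'"
  shows "C2_jet U (\<lambda>x. u x - w x) (\<lambda>x. G x - G' x) (\<lambda>i x. H i x - H' i x)"
proof -
  have *: "((\<lambda>x. p x - q x) has_derivative (\<lambda>v. (g - g') \<bullet> v)) (at x)"
    if "(p has_derivative (\<lambda>v. g \<bullet> v)) (at x)" "(q has_derivative (\<lambda>v. g' \<bullet> v)) (at x)"
    for p q :: "'a \<Rightarrow> real" and g g' x
    using has_derivative_diff[OF that] by (simp add: inner_diff_left)
  show ?thesis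
    using assms unfolding C2_jet_def inner_diff_left
    by (auto intro!: * continuous_on_diff)
qed

lemma partial_deriv_jet:
  assumes "C2_jet U u G H" "x \<in> U"
  shows "partial_deriv u v x = G x \<bullet> v"
proof -
  have "(u has_derivative (\<lambda>v. G x \<bullet> v)) (at x)"
    using assms by (auto simp: C2_jet_def)
  then show ?thesis
    by (metis frechet_derivative_at partial_deriv_def)
qed

lemma partial_deriv2_jet:
  assumes "C2_jet U u G H" "open U" "x \<in> U" "i \<in> Basis"
  shows "((\<lambda>y. partial_deriv u i y) has_derivative (\<lambda>v. H i x \<bullet> v)) (at x)"
    and "partial_deriv (\<lambda>y. partial_deriv u i y) v x = H i x \<bullet> v"
proof -
  have "((\<lambda>y. G y \<bullet> i) has_derivative (\<lambda>v. H i x \<bullet> v)) (at x)"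
    using assms by (auto simp: C2_jet_def)
  then show *: "((\<lambda>y. partial_deriv u i y) has_derivative (\<lambda>v. H i x \<bullet> v)) (at x)"
    by (rule has_derivative_transform_within_open[OF _ assms(2,3)])
       (simp add: partial_deriv_jet[OF assms(1)])
  show "partial_deriv (\<lambda>y. partial_deriv u i y) v x = H i x \<bullet> v"
    using frechet_derivative_at[OF *] unfolding partial_deriv_def by metis
qed

lemma C2_on_jet:
  assumes "C2_jet U u G H" "open U" "\<Omega> \<subseteq> U"
  shows "C2_on \<Omega> u"
  unfolding C2_on_def
proof (intro conjI ballI)
  show "u differentiable_on \<Omega>"
    using assms unfolding C2_jet_def differentiable_on_def
    by (meson differentiable_at_withinI differentiable_def subsetD)
  show "(\<lambda>x. partial_deriv u i x) differentiable_on \<Omega>" if "i \<in> Basis" for i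
    using partial_deriv2_jet(1)[OF assms(1,2) _ that] assms(3) unfolding differentiable_on_def
    by (meson differentiable_at_withinI differentiable_def subsetD)
  fix i j :: "real^'a" assume ij: "i \<in> Basis" "j \<in> Basis"
  have "continuous_on U (H i)"
    using assms(1) ij by (auto simp: C2_jet_def)
  then have "continuous_on \<Omega> (\<lambda>x. H i x \<bullet> j)"
    using assms(3) by (auto intro!: continuous_intros intro: continuous_on_subset)
  then show "continuous_on \<Omega> (\<lambda>x. partial_deriv (\<lambda>y. partial_deriv u i y) j x)"
    by (rule continuous_on_eq)
       (use partial_deriv2_jet(2)[OF assms(1,2) _ ij(1)] assms(3) in auto)
qed

text \<open>In this form the operator is visibly linear in the jet, which is how it later passes
  through differences and through the integral over the poles.\<close>

lemma hyp_laplacian_jet: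
  fixes u :: "real^'n \<Rightarrow> real"
  assumes "C2_jet U u G H" "open U" "x \<in> U"
  shows "hyp_laplacian u x =
    ((1 - (norm x)\<^sup>2) / 2)\<^sup>2 * (\<Sum>i\<in>Basis. H i x \<bullet> i)
      + (real CARD('n) - 2) * ((1 - (norm x)\<^sup>2) / 2) * (G x \<bullet> x)"
  unfolding hyp_laplacian_def eucl_laplacian_def
  by (simp add: partial_deriv_jet[OF assms(1,3)] partial_deriv2_jet(2)[OF assms])

section \<open>Differentiation under the integral sign\<close>

text \<open>With the sigma-algebra of \<open>restrict_space borel S\<close>, continuity on
  \<open>S\<close> alone gives measurability. This suits the kernel, which is singular at the
  interior point \<open>y = x\<close>.\<close>

lemma integrable_continuous_compact:
  fixes f :: "'b::euclidean_space \<Rightarrow> 'c::euclidean_space"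
  assumes "finite_measure M" "sets M = sets (restrict_space borel S)"
    and "compact S" "continuous_on S f"
  shows "integrable M f"
proof -
  interpret finite_measure M by fact
  have sp: "space M = S"
    using sets_eq_imp_space_eq[OF assms(2)] by (simp add: space_restrict_space)
  have "f \<in> borel_measurable (restrict_space borel S)"
    by (rule borel_measurable_continuous_on_restrict) fact
  then have "f \<in> borel_measurable M"
    using measurable_cong_sets[OF assms(2) refl] by blast
  moreover obtain B where "\<And>y. y \<in> S \<Longrightarrow> norm (f y) \<le> B"
    using compact_imp_bounded[OF compact_continuous_image[OF assms(4,3)]]
    by (auto simp: bounded_iff)
  ultimately show ?thesis
    using sp by (intro integrable_const_bound[of _ B]) auto
qed

lemma continuous_on_slice:
  assumes "continuous_on (U \<times> S) (\<lambda>(x,y). f x y)" "x \<in> U"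
  shows "continuous_on S (f x)"
proof -
  have "continuous_on S ((\<lambda>(x,y). f x y) \<circ> (\<lambda>y. (x,y)))"
    by (rule continuous_on_compose)
       (use assms in \<open>auto intro!: continuous_intros intro: continuous_on_subset\<close>)
  then show ?thesis by (simp add: o_def)
qed

lemma continuous_on_integral_compact:
  fixes f :: "'a::euclidean_space \<Rightarrow> 'b::euclidean_space \<Rightarrow> 'c::euclidean_space"
  assumes M: "finite_measure M" "sets M = sets (restrict_space borel S)" "compact S"
    and cont: "continuous_on (U \<times> S) (\<lambda>(x,y). f x y)"
  shows "continuous_on U (\<lambda>x. integral\<^sup>L M (f x))"
  unfolding continuous_on_iff
proof (intro ballI allI impI)
  interpret finite_measure M by fact
  have sp: "space M = S"
    using sets_eq_imp_space_eq[OF M(2)] by (simp add: space_restrict_space)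
  have int: "integrable M (f x)" if "x \<in> U" for x
    using integrable_continuous_compact[OF M continuous_on_slice[OF cont that]] .
  fix x and \<epsilon> :: real assume x: "x \<in> U" "0 < \<epsilon>"
  \<comment> \<open>The summand 1 covers the zero measure and makes the total error strictly smaller
    than \<open>\<epsilon>\<close>.\<close>
  define e where "e = \<epsilon> / (measure M (space M) + 1)"
  have e: "0 < e" "e * measure M (space M) < \<epsilon>"
  proof -
    have "measure M (space M) + 1 > 0" by (simp add: add_nonneg_pos)
    then show "0 < e" "e * measure M (space M) < \<epsilon>"
      using x by (auto simp: e_def field_simps)
  qed
  obtain X where X: "x \<in> X" "open X"
    "\<forall>z\<in>X \<inter> U. \<forall>y\<in>S. dist (case (z,y) of (x,y) \<Rightarrow> f x y) (case (x,y) of (x,y) \<Rightarrow> f x y) \<le> e"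
    using continuous_on_prod_compactE[OF cont M(3) x(1) e(1)] by auto
  obtain d where d: "d > 0" "ball x d \<subseteq> X"
    using X openE by blast
  show "\<exists>d>0. \<forall>z\<in>U. dist z x < d \<longrightarrow> dist (integral\<^sup>L M (f z)) (integral\<^sup>L M (f x)) < \<epsilon>"
  proof (intro exI[of _ d] conjI ballI impI d(1))
    fix z assume z: "z \<in> U" "dist z x < d"
    then have "z \<in> X \<inter> U" using d by (auto simp: dist_commute)
    then have le: "norm (f z y - f x y) \<le> e" if "y \<in> S" for y
      using X(3) that by (auto simp: dist_norm)
    have "dist (integral\<^sup>L M (f z)) (integral\<^sup>L M (f x)) = norm (\<integral>y. f z y - f x y \<partial>M)"
      using int x z by (simp add: dist_norm)
    also have "\<dots> \<le> (\<integral>y. norm (f z y - f x y) \<partial>M)"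
      by (rule integral_norm_bound)
    also have "\<dots> \<le> (\<integral>y. e \<partial>M)"
      by (rule integral_mono) (use le sp int x z in auto)
    also have "\<dots> < \<epsilon>" using e by (simp add: mult.commute)
    finally show "dist (integral\<^sup>L M (f z)) (integral\<^sup>L M (f x)) < \<epsilon>" .
  qed
qed

text \<open>Compactness of \<open>S\<close> takes the place of a dominating function: near
  \<open>x\<close> the gradients \<open>G z y\<close> are close to \<open>G x y\<close> uniformly in
  \<open>y\<close>, so the first-order remainder is uniformly small and can be integrated.\<close>

lemma has_derivative_integral_compact:
  fixes f :: "'a::euclidean_space \<Rightarrow> 'b::euclidean_space \<Rightarrow> real"
  assumes M: "finite_measure M" "sets M = sets (restrict_space borel S)" "compact S"
    and U: "open U" "x \<in> U"
    and cont: "continuous_on (U \<times> S) (\<lambda>(x,y). G x y)"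
    and contf: "\<And>z. z \<in> U \<Longrightarrow> continuous_on S (f z)"
    and der: "\<And>z y. z \<in> U \<Longrightarrow> y \<in> S \<Longrightarrow> ((\<lambda>z. f z y) has_derivative (\<lambda>v. G z y \<bullet> v)) (at z)"
  shows "((\<lambda>z. \<integral>y. f z y \<partial>M) has_derivative (\<lambda>v. (\<integral>y. G x y \<partial>M) \<bullet> v)) (at x)"
proof -
  interpret finite_measure M by fact
  have sp: "space M = S"
    using sets_eq_imp_space_eq[OF M(2)] by (simp add: space_restrict_space)
  have intf: "integrable M (f z)" if "z \<in> U" for z
    using integrable_continuous_compact[OF M contf[OF that]] .
  have intG: "integrable M (G x)"
    using integrable_continuous_compact[OF M continuous_on_slice[OF cont U(2)]] .
  show ?thesis
    unfolding has_derivative_within_alt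
  proof (intro conjI allI impI)
    show "bounded_linear (\<lambda>v. (\<integral>y. G x y \<partial>M) \<bullet> v)"
      by (rule bounded_linear_inner_right)
    fix \<epsilon> :: real assume \<epsilon>: "0 < \<epsilon>"
    define e where "e = \<epsilon> / (measure M (space M) + 1)"
    have "measure M (space M) + 1 > 0" by (simp add: add_nonneg_pos)
    then have e: "0 < e" "e * measure M (space M) \<le> \<epsilon>"
      using \<epsilon> by (auto simp: e_def field_simps)
    obtain X where X: "x \<in> X" "open X"
      "\<forall>z\<in>X \<inter> U. \<forall>y\<in>S. dist (case (z,y) of (x,y) \<Rightarrow> G x y) (case (x,y) of (x,y) \<Rightarrow> G x y) \<le> e"
      using continuous_on_prod_compactE[OF cont M(3) U(2) e(1)] by auto
    obtain d where d: "d > 0" "ball x d \<subseteq> X \<inter> U"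
      using X U by (metis IntI open_Int openE)
    show "\<exists>d>0. \<forall>z\<in>UNIV. norm (z - x) < d \<longrightarrow>
        norm ((\<integral>y. f z y \<partial>M) - (\<integral>y. f x y \<partial>M) - (\<integral>y. G x y \<partial>M) \<bullet> (z - x)) \<le> \<epsilon> * norm (z - x)"
    proof (intro exI[of _ d] conjI ballI impI d(1))
      fix z assume "norm (z - x) < d"
      then have z: "z \<in> ball x d" by (simp add: dist_norm norm_minus_commute)
      then have zU: "z \<in> U" using d by auto
      have le: "norm (f z y - f x y - G x y \<bullet> (z - x)) \<le> e * norm (z - x)" if y: "y \<in> S" for y
      proof -
        \<comment> \<open>After subtracting the linear function \<open>G x y \<bullet> z\<close>,
          the remaining gradient \<open>G w y - G x y\<close> is at most \<open>e\<close> on the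
          ball, and the mean value inequality bounds the remainder.\<close>
        have "norm ((f z y - G x y \<bullet> z) - (f x y - G x y \<bullet> x)) \<le> e * norm (z - x)"
        proof (rule differentiable_bound[of "ball x d" _ "\<lambda>z v. (G z y - G x y) \<bullet> v"])
          fix w assume w: "w \<in> ball x d"
          then have "w \<in> U" using d by auto
          then have "((\<lambda>z. f z y - G x y \<bullet> z) has_derivative (\<lambda>v. G w y \<bullet> v - G x y \<bullet> v)) (at w)"
            by (intro has_derivative_diff der y has_derivative_inner_right has_derivative_ident)
          then show "((\<lambda>z. f z y - G x y \<bullet> z) has_derivative (\<lambda>v. (G w y - G x y) \<bullet> v))
              (at w within ball x d)"
            by (simp add: inner_diff_left has_derivative_at_withinI)
          have "norm (G w y - G x y) \<le> e"
            using X(3) subsetD[OF d(2) w] y by (auto simp: dist_norm)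
          then show "onorm ((\<bullet>) (G w y - G x y)) \<le> e"
            unfolding real_norm_def[symmetric]
            by (intro onorm_le order_trans[OF Cauchy_Schwarz_ineq2[folded real_norm_def]] mult_right_mono) auto
        qed (use z d in auto)
        then show ?thesis by (simp add: inner_diff_right algebra_simps)
      qed
      have "(\<integral>y. f z y \<partial>M) - (\<integral>y. f x y \<partial>M) - (\<integral>y. G x y \<partial>M) \<bullet> (z - x)
          = (\<integral>y. f z y - f x y - G x y \<bullet> (z - x) \<partial>M)"
        using intf[OF zU] intf[OF U(2)] intG by simp
      also have "norm \<dots> \<le> (\<integral>y. norm (f z y - f x y - G x y \<bullet> (z - x)) \<partial>M)"
        by (rule integral_norm_bound)
      also have "\<dots> \<le> (\<integral>y. e * norm (z - x) \<partial>M)"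
        by (rule integral_mono) (use le sp intf[OF zU] intf[OF U(2)] intG in auto)
      also have "\<dots> = (e * measure M (space M)) * norm (z - x)" by simp
      also have "\<dots> \<le> \<epsilon> * norm (z - x)"
        using e by (intro mult_right_mono) auto
      finally show "norm ((\<integral>y. f z y \<partial>M) - (\<integral>y. f x y \<partial>M) - (\<integral>y. G x y \<partial>M) \<bullet> (z - x))
          \<le> \<epsilon> * norm (z - x)" .
    qed
  qed
qed

lemma C2_jet_integral:
  fixes f :: "'a::euclidean_space \<Rightarrow> 'b::euclidean_space \<Rightarrow> real"
  assumes M: "finite_measure M" "sets M = sets (restrict_space borel S)" "compact S"
    and U: "open U"
    and jet: "\<And>y. y \<in> S \<Longrightarrow> C2_jet U (\<lambda>x. f x y) (\<lambda>x. G x y) (\<lambda>i x. H i x y)"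
    and cf: "\<And>x. x \<in> U \<Longrightarrow> continuous_on S (f x)"
    and cG: "continuous_on (U \<times> S) (\<lambda>(x,y). G x y)"
    and cH: "\<And>i. i \<in> Basis \<Longrightarrow> continuous_on (U \<times> S) (\<lambda>(x,y). H i x y)"
  shows "C2_jet U (\<lambda>x. \<integral>y. f x y \<partial>M) (\<lambda>x. \<integral>y. G x y \<partial>M) (\<lambda>i x. \<integral>y. H i x y \<partial>M)"
  unfolding C2_jet_def
proof (intro conjI ballI)
  have intG: "integrable M (G x)" if "x \<in> U" for x
    using integrable_continuous_compact[OF M continuous_on_slice[OF cG that]] .
  fix x assume x: "x \<in> U"
  show "((\<lambda>x. \<integral>y. f x y \<partial>M) has_derivative (\<lambda>v. (\<integral>y. G x y \<partial>M) \<bullet> v)) (at x)"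
    by (rule has_derivative_integral_compact[OF M U x cG cf]) (use jet in \<open>auto simp: C2_jet_def\<close>)
  fix i :: 'a assume i: "i \<in> Basis"
  have "((\<lambda>x. \<integral>y. G x y \<bullet> i \<partial>M) has_derivative (\<lambda>v. (\<integral>y. H i x y \<partial>M) \<bullet> v)) (at x)"
    by (rule has_derivative_integral_compact[OF M U x cH[OF i]])
       (use jet i continuous_on_slice[OF cG] in \<open>auto simp: C2_jet_def intro!: continuous_intros\<close>)
  then show "((\<lambda>x. (\<integral>y. G x y \<partial>M) \<bullet> i) has_derivative (\<lambda>v. (\<integral>y. H i x y \<partial>M) \<bullet> v)) (at x)"
    by (rule has_derivative_transform_within_open[OF _ U x]) (use intG in simp)
next
  fix i :: 'a assume i: "i \<in> Basis"
  show "continuous_on U (\<lambda>x. \<integral>y. H i x y \<partial>M)"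
    by (rule continuous_on_integral_compact[OF M cH[OF i]])
qed

section \<open>The Poisson kernel of the ball\<close>

text \<open>This is minus the Busemann function of the boundary point \<open>y\<close>, normalised
  at the origin: its level sets are horospheres at \<open>y\<close>, and the power n-1 of its
  exponential is the hyperbolic Poisson kernel. The two logarithms are kept apart so that the
  squared norms are differentiated separately.\<close>

definition ln_poisson :: "'a::euclidean_space \<Rightarrow> 'a \<Rightarrow> real" where
  "ln_poisson x y = ln (1 - (norm x)\<^sup>2) - ln ((norm (x - y))\<^sup>2)"

definition ln_poisson_grad :: "'a::euclidean_space \<Rightarrow> 'a \<Rightarrow> 'a" where
  "ln_poisson_grad x y =
     - (2 / (1 - (norm x)\<^sup>2)) *\<^sub>R x - (2 / (norm (x - y))\<^sup>2) *\<^sub>R (x - y)"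

definition ln_poisson_hess :: "'a::euclidean_space \<Rightarrow> 'a \<Rightarrow> 'a \<Rightarrow> 'a" where
  "ln_poisson_hess i x y =
     - (2 / (1 - (norm x)\<^sup>2)) *\<^sub>R i - (4 * (x \<bullet> i) / (1 - (norm x)\<^sup>2)\<^sup>2) *\<^sub>R x
     - (2 / (norm (x - y))\<^sup>2) *\<^sub>R i + (4 * ((x - y) \<bullet> i) / ((norm (x - y))\<^sup>2)\<^sup>2) *\<^sub>R (x - y)"

lemma ball_sphere_pos:
  fixes x y :: "'a::euclidean_space"
  assumes "x \<in> ball 0 1" "y \<in> sphere 0 1"
  shows "0 < 1 - (norm x)\<^sup>2" "0 < (norm (x - y))\<^sup>2"
  using assms by (auto simp: power2_eq_1_iff power_less_one_iff abs_square_less_1)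

lemma has_derivative_norm_sqr:
  fixes x y :: "'a::euclidean_space"
  shows "((\<lambda>x. (norm (x - y))\<^sup>2) has_derivative (\<lambda>v. 2 * ((x - y) \<bullet> v))) (at x)"
proof -
  have "((\<lambda>x. (x - y) \<bullet> (x - y)) has_derivative (\<lambda>v. 2 * ((x - y) \<bullet> v))) (at x)"
    by (auto intro!: derivative_eq_intros simp: inner_commute)
  then show ?thesis by (simp add: power2_norm_eq_inner)
qed

lemma has_derivative_one_minus_norm_sqr:
  fixes x :: "'a::euclidean_space"
  shows "((\<lambda>x. 1 - (norm x)\<^sup>2) has_derivative (\<lambda>v. - 2 * (x \<bullet> v))) (at x)"
  using has_derivative_diff[OF has_derivative_const[of 1] has_derivative_norm_sqr[of 0 x]] by simp

lemma has_derivative_ln_poisson: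
  fixes x y :: "'a::euclidean_space"
  assumes "x \<in> ball 0 1" "y \<in> sphere 0 1"
  shows "((\<lambda>x. ln_poisson x y) has_derivative (\<lambda>v. ln_poisson_grad x y \<bullet> v)) (at x)"
proof -
  note pos = ball_sphere_pos[OF assms]
  show ?thesis
    unfolding ln_poisson_def
    by (rule has_derivative_eq_rhs[OF has_derivative_diff[OF
          has_derivative_ln[OF pos(1) has_derivative_one_minus_norm_sqr]
          has_derivative_ln[OF pos(2) has_derivative_norm_sqr]]])
       (simp add: ln_poisson_grad_def inner_diff_left inner_add_left inner_minus_left fun_eq_iff
          divide_inverse algebra_simps)
qed

lemma has_derivative_ln_poisson_grad:
  fixes x y :: "'a::euclidean_space"
  assumes "x \<in> ball 0 1" "y \<in> sphere 0 1"
  shows "((\<lambda>x. ln_poisson_grad x y \<bullet> i) has_derivative (\<lambda>v. ln_poisson_hess i x y \<bullet> v)) (at x)"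
proof -
  note pos = ball_sphere_pos[OF assms]
  define h q where "h = 1 - (norm x)\<^sup>2" and "q = (norm (x - y))\<^sup>2"
  have nz: "h \<noteq> 0" "q \<noteq> 0" using pos by (auto simp: h_def q_def)
  have A: "((\<lambda>x. 2 / (1 - (norm x)\<^sup>2)) has_derivative (\<lambda>v. 4 * (x \<bullet> v) / h\<^sup>2)) (at x)"
    using pos unfolding h_def
    by (intro has_derivative_eq_rhs[OF has_derivative_divide[OF has_derivative_const
          has_derivative_one_minus_norm_sqr]])
       (auto simp: fun_eq_iff power2_eq_square divide_inverse)
  have B: "((\<lambda>x. 2 / (norm (x - y))\<^sup>2) has_derivative (\<lambda>v. - 4 * ((x - y) \<bullet> v) / q\<^sup>2)) (at x)"
    using pos unfolding q_def
    by (intro has_derivative_eq_rhs[OF has_derivative_divide[OF has_derivative_const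
          has_derivative_norm_sqr]])
       (auto simp: fun_eq_iff power2_eq_square divide_inverse)
  have A': "((\<lambda>x. 2 / (1 - (norm x)\<^sup>2) * (x \<bullet> i)) has_derivative
      (\<lambda>v. 2 / h * (v \<bullet> i) + 4 * (x \<bullet> v) / h\<^sup>2 * (x \<bullet> i))) (at x)"
    unfolding h_def
    by (rule has_derivative_mult[OF A[unfolded h_def] has_derivative_inner_left[OF has_derivative_ident]])
  have B': "((\<lambda>x. 2 / (norm (x - y))\<^sup>2 * ((x - y) \<bullet> i)) has_derivative
      (\<lambda>v. 2 / q * ((v - 0) \<bullet> i) + - 4 * ((x - y) \<bullet> v) / q\<^sup>2 * ((x - y) \<bullet> i))) (at x)"
    unfolding q_def
    by (rule has_derivative_mult[OF B[unfolded q_def] has_derivative_inner_left[OF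
          has_derivative_diff[OF has_derivative_ident has_derivative_const]]])
  have eq: "(\<lambda>x. ln_poisson_grad x y \<bullet> i) =
      (\<lambda>x. - (2 / (1 - (norm x)\<^sup>2) * (x \<bullet> i)) - 2 / (norm (x - y))\<^sup>2 * ((x - y) \<bullet> i))"
    by (simp add: ln_poisson_grad_def fun_eq_iff inner_diff_left)
  show ?thesis
    unfolding eq
    by (rule has_derivative_eq_rhs[OF has_derivative_diff[OF has_derivative_minus[OF A'] B']])
       (simp add: ln_poisson_hess_def fun_eq_iff inner_diff_left inner_add_left
          inner_minus_left inner_commute[of _ i] right_diff_distrib left_diff_distrib
          diff_divide_distrib mult.commute mult.left_commute flip: h_def q_def)
qed

lemma continuous_on_ln_poisson:
  fixes s :: "('a::euclidean_space \<times> 'a) set"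
  assumes "s \<subseteq> ball 0 1 \<times> sphere 0 1"
  shows "continuous_on s (\<lambda>(x,y). ln_poisson x y)"
    and "continuous_on s (\<lambda>(x,y). ln_poisson_grad x y)"
    and "continuous_on s (\<lambda>(x,y). ln_poisson_hess i x y)"
proof -
  have nz: "1 - (norm (fst p))\<^sup>2 \<noteq> 0" "(norm (fst p - snd p))\<^sup>2 \<noteq> 0" if "p \<in> s" for p
    using ball_sphere_pos[of "fst p" "snd p"] that assms by fastforce+
  then have nz': "fst p \<noteq> snd p" if "p \<in> s" for p
    using that by fastforce
  show "continuous_on s (\<lambda>(x,y). ln_poisson x y)"
    unfolding ln_poisson_def case_prod_unfold
    by (intro continuous_intros) (use nz nz' in auto)
  show "continuous_on s (\<lambda>(x,y). ln_poisson_grad x y)"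
    unfolding ln_poisson_grad_def case_prod_unfold
    by (intro continuous_intros) (use nz nz' in auto)
  show "continuous_on s (\<lambda>(x,y). ln_poisson_hess i x y)"
    unfolding ln_poisson_hess_def case_prod_unfold
    by (intro continuous_intros) (use nz nz' in auto)
qed

text \<open>First and second order data of \<open>f \<circ> L\<close>, where \<open>L = ln_poisson\<close>, \<open>f1 = f'\<close> and \<open>f2 = f''\<close>.\<close>

definition profile_grad :: "(real \<Rightarrow> real) \<Rightarrow> 'a::euclidean_space \<Rightarrow> 'a \<Rightarrow> 'a" where
  "profile_grad f1 x y = f1 (ln_poisson x y) *\<^sub>R ln_poisson_grad x y"

definition profile_hess ::
  "(real \<Rightarrow> real) \<Rightarrow> (real \<Rightarrow> real) \<Rightarrow> 'a::euclidean_space \<Rightarrow> 'a \<Rightarrow> 'a \<Rightarrow> 'a" where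
  "profile_hess f1 f2 i x y =
     (f2 (ln_poisson x y) * (ln_poisson_grad x y \<bullet> i)) *\<^sub>R ln_poisson_grad x y
       + f1 (ln_poisson x y) *\<^sub>R ln_poisson_hess i x y"

lemma continuous_on_profile:
  fixes s :: "('a::euclidean_space \<times> 'a) set"
  assumes "s \<subseteq> ball 0 1 \<times> sphere 0 1" "continuous_on UNIV f" "continuous_on UNIV f1"
  shows "continuous_on s (\<lambda>(x,y). f (ln_poisson x y))"
    and "continuous_on s (\<lambda>(x,y). profile_grad f x y)"
    and "continuous_on s (\<lambda>(x,y). profile_hess f f1 i x y)"
proof -
  note L = continuous_on_ln_poisson[OF assms(1), unfolded case_prod_unfold]
  have cf: "continuous_on s (\<lambda>p. f (ln_poisson (fst p) (snd p)))"
    and cf1: "continuous_on s (\<lambda>p. f1 (ln_poisson (fst p) (snd p)))"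
    by (rule continuous_on_compose2[OF assms(2) L(1)]; simp)
       (rule continuous_on_compose2[OF assms(3) L(1)]; simp)
  show "continuous_on s (\<lambda>(x,y). f (ln_poisson x y))"
    unfolding case_prod_unfold by (rule cf)
  show "continuous_on s (\<lambda>(x,y). profile_grad f x y)"
    unfolding case_prod_unfold profile_grad_def by (intro continuous_intros cf L)
  show "continuous_on s (\<lambda>(x,y). profile_hess f f1 i x y)"
    unfolding case_prod_unfold profile_hess_def by (intro continuous_intros cf cf1 L)
qed

lemma C2_jet_profile:
  fixes y :: "'a::euclidean_space"
  assumes y: "y \<in> sphere 0 1"
    and f: "\<And>t. (f has_real_derivative f1 t) (at t)" "\<And>t. (f1 has_real_derivative f2 t) (at t)"
    and cf2: "continuous_on UNIV f2"
  shows "C2_jet (ball 0 1) (\<lambda>x. f (ln_poisson x y)) (\<lambda>x. profile_grad f1 x y)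
           (\<lambda>i x. profile_hess f1 f2 i x y)"
  unfolding C2_jet_def
proof (intro conjI ballI)
  fix x :: 'a assume x: "x \<in> ball 0 1"
  note dL = has_derivative_ln_poisson[OF x y]
  have chain: "((\<lambda>x. g (ln_poisson x y)) has_derivative
      (\<lambda>v. g' (ln_poisson x y) * (ln_poisson_grad x y \<bullet> v))) (at x)"
    if "\<And>t. (g has_real_derivative g' t) (at t)" for g g'
    using has_derivative_compose[OF dL, of g "(*) (g' (ln_poisson x y))"] that
    by (simp add: has_field_derivative_def)
  show "((\<lambda>x. f (ln_poisson x y)) has_derivative (\<lambda>v. profile_grad f1 x y \<bullet> v)) (at x)"
    using chain[of f f1] f by (simp add: profile_grad_def)
  fix i :: 'a
  show "((\<lambda>x. profile_grad f1 x y \<bullet> i) has_derivative (\<lambda>v. profile_hess f1 f2 i x y \<bullet> v)) (at x)"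
    using has_derivative_mult[OF chain[of f1 f2] has_derivative_ln_poisson_grad[OF x y, of i]] f
    by (simp add: profile_grad_def profile_hess_def inner_add_left algebra_simps)
next
  fix i :: 'a
  have cf1: "continuous_on UNIV f1"
    using f(2) by (meson DERIV_isCont continuous_at_imp_continuous_on)
  have "continuous_on (ball 0 1) ((\<lambda>(x,y). profile_hess f1 f2 i x y) \<circ> (\<lambda>x. (x,y)))"
    by (intro continuous_on_compose continuous_on_profile cf1 cf2 continuous_intros)
       (use y in auto)
  then show "continuous_on (ball 0 1) (\<lambda>x. profile_hess f1 f2 i x y)"
    by (simp add: o_def)
qed

text \<open>The first identity says that a Busemann function has hyperbolic gradient of length 1.
  Every inner product that occurs is expressed through \<open>h = 1 - |x|^2\<close> and
  \<open>q = |x - y|^2\<close>.\<close>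

lemma ln_poisson_grad_norm:
  fixes x y :: "'a::euclidean_space"
  assumes "x \<in> ball 0 1" "y \<in> sphere 0 1"
  shows "(1 - (norm x)\<^sup>2)\<^sup>2 * (ln_poisson_grad x y \<bullet> ln_poisson_grad x y) = 4"
    and "ln_poisson_grad x y \<bullet> x
           = 1 - 2 / (1 - (norm x)\<^sup>2) + (1 - (norm x)\<^sup>2) / (norm (x - y))\<^sup>2"
proof -
  define h q where "h = 1 - (norm x)\<^sup>2" and "q = (norm (x - y))\<^sup>2"
  have pos: "h > 0" "q > 0" using ball_sphere_pos[OF assms] by (auto simp: h_def q_def)
  have yy: "y \<bullet> y = 1" using assms by (simp add: dot_square_norm)
  have xx: "x \<bullet> x = 1 - h" by (simp add: h_def dot_square_norm)
  have qq: "(x - y) \<bullet> (x - y) = q" by (simp add: q_def dot_square_norm)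
  \<comment> \<open>Expand \<open>1 = |y|^2 = |x - (x - y)|^2 = (1 - h) - 2 (x \<bullet> (x - y)) +
    q\<close>.\<close>
  have xq: "x \<bullet> (x - y) = (q - h) / 2"
    using qq xx yy by (simp add: inner_diff_left inner_diff_right inner_commute)
  have g: "ln_poisson_grad x y = - (2 / h) *\<^sub>R x - (2 / q) *\<^sub>R (x - y)"
    by (simp add: ln_poisson_grad_def h_def q_def)
  have "ln_poisson_grad x y \<bullet> ln_poisson_grad x y
     = 4 / h\<^sup>2 * (x \<bullet> x) + 8 / (h * q) * (x \<bullet> (x - y)) + 4 / q\<^sup>2 * ((x - y) \<bullet> (x - y))"
    unfolding g inner_diff_left[of "- (2 / h) *\<^sub>R x" "(2 / q) *\<^sub>R (x - y)"]
      inner_diff_right[of _ "- (2 / h) *\<^sub>R x" "(2 / q) *\<^sub>R (x - y)"]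
    by (simp add: inner_commute[of "x - y" x] power2_eq_square)
  also have "\<dots> = 4 / h\<^sup>2"
    unfolding xx xq qq using pos by (simp add: field_simps power2_eq_square)
  finally show "(1 - (norm x)\<^sup>2)\<^sup>2 * (ln_poisson_grad x y \<bullet> ln_poisson_grad x y) = 4"
    using pos by (simp flip: h_def)
  have "ln_poisson_grad x y \<bullet> x = - (2 / h) * (x \<bullet> x) - 2 / q * (x \<bullet> (x - y))"
    unfolding g inner_diff_left[of "- (2 / h) *\<^sub>R x" "(2 / q) *\<^sub>R (x - y)"]
    by (simp add: inner_commute)
  also have "\<dots> = 1 - 2 / h + h / q"
    unfolding xx xq using pos by (simp add: field_simps)
  finally show "ln_poisson_grad x y \<bullet> x
      = 1 - 2 / (1 - (norm x)\<^sup>2) + (1 - (norm x)\<^sup>2) / (norm (x - y))\<^sup>2"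
    by (simp add: h_def q_def)
qed

lemma trace_ln_poisson_hess:
  fixes x y :: "'a::euclidean_space"
  assumes "x \<in> ball 0 1" "y \<in> sphere 0 1"
  shows "(\<Sum>i\<in>Basis. ln_poisson_hess i x y \<bullet> i) =
     4 / (1 - (norm x)\<^sup>2) - 4 / (1 - (norm x)\<^sup>2)\<^sup>2 - 2 * real DIM('a) / (1 - (norm x)\<^sup>2)
       - (2 * real DIM('a) - 4) / (norm (x - y))\<^sup>2"
proof -
  define h q where "h = 1 - (norm x)\<^sup>2" and "q = (norm (x - y))\<^sup>2"
  have pos: "h > 0" "q > 0" using ball_sphere_pos[OF assms] by (auto simp: h_def q_def)
  have xx: "x \<bullet> x = 1 - h" by (simp add: h_def dot_square_norm)
  have qq: "(x - y) \<bullet> (x - y) = q" by (simp add: q_def dot_square_norm)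
  have "(\<Sum>i\<in>Basis. ln_poisson_hess i x y \<bullet> i) =
     (\<Sum>i\<in>Basis. (- (2 / h) - 2 / q) - 4 / h\<^sup>2 * ((x \<bullet> i) * (x \<bullet> i))
        + 4 / q\<^sup>2 * (((x - y) \<bullet> i) * ((x - y) \<bullet> i)))"
    by (rule sum.cong)
       (auto simp: ln_poisson_hess_def inner_diff_left inner_add_left algebra_simps
         add_divide_distrib diff_divide_distrib simp flip: h_def q_def)
  also have "\<dots> = real DIM('a) * (- (2 / h) - 2 / q) - 4 / h\<^sup>2 * (x \<bullet> x) + 4 / q\<^sup>2 * ((x - y) \<bullet> (x - y))"
    by (simp only: sum.distrib sum_subtractf sum_distrib_left[symmetric] euclidean_inner[symmetric]
        sum_constant right_diff_distrib)
  also have "\<dots> = 4 / h - 4 / h\<^sup>2 - 2 * real DIM('a) / h - (2 * real DIM('a) - 4) / q"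
    unfolding xx qq using pos by (simp add: field_simps power2_eq_square)
  finally show ?thesis by (simp add: h_def q_def)
qed

text \<open>Chain rule \<open>Delta (f o L) = f'' |grad L|^2 + f' Delta L\<close> with
  \<open>|grad L| = 1\<close> and \<open>Delta L = -(n-1)\<close>. The eigenvalue equation for
  functions of \<open>L\<close> is thus the ODE
  \<open>f'' - 2 \<alpha> f' + \<alpha>^2 f = 0\<close>, with basis \<open>exp (\<alpha> t)\<close>
  and \<open>t exp (\<alpha> t)\<close>.\<close>

lemma hyp_laplacian_profile:
  fixes x y :: "'a::euclidean_space"
  assumes "x \<in> ball 0 1" "y \<in> sphere 0 1"
  shows "((1 - (norm x)\<^sup>2) / 2)\<^sup>2 * (\<Sum>i\<in>Basis. profile_hess f1 f2 i x y \<bullet> i)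
      + (real DIM('a) - 2) * ((1 - (norm x)\<^sup>2) / 2) * (profile_grad f1 x y \<bullet> x)
      = f2 (ln_poisson x y) - (real DIM('a) - 1) * f1 (ln_poisson x y)"
proof -
  define h q g where "h = 1 - (norm x)\<^sup>2" and "q = (norm (x - y))\<^sup>2"
    and "g = ln_poisson_grad x y"
  define F1 F2 n where "F1 = f1 (ln_poisson x y)" and "F2 = f2 (ln_poisson x y)" and "n = real DIM('a)"
  have pos: "h > 0" "q > 0" using ball_sphere_pos[OF assms] by (auto simp: h_def q_def)
  have gg: "g \<bullet> g = 4 / h\<^sup>2" and gx: "g \<bullet> x = 1 - 2 / h + h / q"
    using ln_poisson_grad_norm[OF assms] pos by (auto simp: g_def h_def q_def field_simps)
  have "(\<Sum>i\<in>Basis. profile_hess f1 f2 i x y \<bullet> i)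
      = (\<Sum>i\<in>Basis. F2 * ((g \<bullet> i) * (g \<bullet> i)) + F1 * (ln_poisson_hess i x y \<bullet> i))"
    by (simp add: profile_hess_def F1_def F2_def g_def inner_add_left mult.assoc)
  also have "\<dots> = F2 * (g \<bullet> g) + F1 * (\<Sum>i\<in>Basis. ln_poisson_hess i x y \<bullet> i)"
    by (simp only: sum.distrib sum_distrib_left[symmetric] euclidean_inner[symmetric])
  also have "\<dots> = F2 * (4 / h\<^sup>2) + F1 * (4 / h - 4 / h\<^sup>2 - 2 * n / h - (2 * n - 4) / q)"
    unfolding trace_ln_poisson_hess[OF assms] gg by (simp add: h_def q_def n_def)
  finally have tr: "(\<Sum>i\<in>Basis. profile_hess f1 f2 i x y \<bullet> i) = \<dots>" .
  have "(h / 2)\<^sup>2 * (F2 * (4 / h\<^sup>2) + F1 * (4 / h - 4 / h\<^sup>2 - 2 * n / h - (2 * n - 4) / q))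
      + (n - 2) * (h / 2) * (F1 * (1 - 2 / h + h / q)) = F2 - (n - 1) * F1"
    using pos by (simp add: field_simps power2_eq_square)
  then show ?thesis
    unfolding tr by (simp add: profile_grad_def F1_def F2_def n_def h_def q_def
        gx[unfolded g_def h_def q_def])
qed

section \<open>Eigenfunctions from Frostman measures\<close>

text \<open>Take the least \<open>k\<close> with \<open>(1/2)^k < \<rho>\<close>. For
  \<open>k = 0\<close> minimality says nothing, and the second inequality is the hypothesis
  \<open>\<rho> \<le> 2\<close>, which holds for distances in the closed unit ball.\<close>

lemma dyadic_scale:
  fixes \<rho> :: real
  assumes "0 < \<rho>" "\<rho> \<le> 2"
  shows "\<exists>k::nat. (1/2)^k < \<rho> \<and> \<rho> \<le> 2 * (1/2)^k"
proof -
  define k where "k = (LEAST k. (1/2::real)^k < \<rho>)"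
  have ex: "\<exists>k. (1/2::real)^k < \<rho>"
    using assms by (intro real_arch_pow_inv) auto
  then have 1: "(1/2)^k < \<rho>"
    unfolding k_def by (rule LeastI_ex)
  have 2: "\<rho> \<le> 2 * (1/2)^k"
  proof (cases k)
    case 0
    then show ?thesis using assms by simp
  next
    case (Suc j)
    then have "\<not> (1/2)^j < \<rho>"
      using not_less_Least[of j "\<lambda>k. (1/2::real)^k < \<rho>"] by (simp add: k_def)
    then show ?thesis by (simp add: Suc)
  qed
  show ?thesis using 1 2 by blast
qed

text \<open>Since \<open>1 - |x|\<close> is the distance from \<open>x\<close> to the sphere and
  \<open>1 + |x| \<le> 2\<close>. It bounds the exponential of \<open>ln_poisson x y\<close> by
  \<open>2 / |x - y|\<close>.\<close>

lemma one_minus_norm_sqr_le: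
  fixes x y :: "'a::euclidean_space"
  assumes "x \<in> ball 0 1" "y \<in> sphere 0 1"
  shows "1 - (norm x)\<^sup>2 \<le> 2 * norm (x - y)"
proof -
  have "1 - norm x \<le> norm (x - y)"
    using norm_triangle_ineq2[of y x] assms by (simp add: norm_minus_commute)
  moreover have "(1 - norm x) * (1 + norm x) \<le> (1 - norm x) * 2"
    using assms by (intro mult_left_mono) auto
  ultimately show ?thesis by (simp add: power2_eq_square algebra_simps)
qed

definition poisson_potential :: "real \<Rightarrow> 'a::euclidean_space measure \<Rightarrow> 'a \<Rightarrow> real" where
  "poisson_potential \<alpha> \<mu> x = (\<integral>\<xi>. exp (\<alpha> * ln_poisson x \<xi>) \<partial>\<mu>)"

text \<open>The upper density refers to balls around arbitrary points because the potential is
  estimated with balls around interior points \<open>x\<close>. The lower density is asked only on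
  \<open>D\<close>, the set that is parametrised explicitly; \<open>closure D\<close> is the later
  Cantor set.\<close>

locale frostman =
  fixes \<mu> :: "(real^'n) measure" and D :: "(real^'n) set" and e :: "real^'n" and \<alpha> s c C :: real
  assumes finite_measure: "finite_measure \<mu>"
    and sets_\<mu>: "sets \<mu> = sets (restrict_space borel (sphere 0 1))"
    and \<alpha>: "\<alpha> = (real CARD('n) - 1) / 2" and s_gt: "\<alpha> < s" and s_lt: "s < 2 * \<alpha>"
    and upper: "\<And>x r. 0 < r \<Longrightarrow> measure \<mu> (cball x r \<inter> sphere 0 1) \<le> C * r powr s"
    and c_pos: "0 < c"
    and lower: "\<And>\<xi> \<delta>. \<xi> \<in> D \<Longrightarrow> 0 < \<delta> \<Longrightarrow>
      \<exists>r. 0 < r \<and> r < \<delta> \<and> c * r powr s \<le> measure \<mu> (cball \<xi> r \<inter> sphere 0 1)"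
    and support: "AE \<xi> in \<mu>. \<xi> \<in> closure D"
    and D: "D \<subseteq> sphere 0 1" "D \<noteq> {}"
    and e: "e \<in> sphere 0 1" "e \<notin> closure D"
begin

sublocale finite_measure \<mu> by (rule finite_measure)

abbreviation v :: "real^'n \<Rightarrow> real" where
  "v \<equiv> poisson_potential \<alpha> \<mu>"

lemma \<alpha>_pos: "0 < \<alpha>"
  using s_gt s_lt by simp

lemma space_\<mu>: "space \<mu> = sphere 0 1"
  using sets_eq_imp_space_eq[OF sets_\<mu>] by (simp add: space_restrict_space)

lemma closed_inter_sphere_sets: "closed A \<Longrightarrow> A \<inter> sphere 0 1 \<in> sets \<mu>"
  unfolding sets_\<mu> by (auto simp: sets_restrict_space)

section \<open>Boundedness of the potential and its decay away from the support\<close>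

lemma integrable_kernel:
  assumes "x \<in> ball 0 1"
  shows "integrable \<mu> (\<lambda>\<xi>. exp (\<alpha> * ln_poisson x \<xi>))"
proof (rule integrable_continuous_compact[OF finite_measure sets_\<mu> compact_sphere])
  have "continuous_on (ball 0 1 \<times> sphere 0 1) (\<lambda>(x,y). exp (\<alpha> * ln_poisson x y) :: real)"
    by (intro continuous_on_profile(1)[where f="\<lambda>t. exp (\<alpha> * t)"] continuous_intros) auto
  then show "continuous_on (sphere 0 1) (\<lambda>\<xi>. exp (\<alpha> * ln_poisson x \<xi>))"
    using continuous_on_slice assms by fast
qed

text \<open>Sum over dyadic shells around \<open>x\<close>, each enlarged to a ball: scale
  \<open>k\<close> contributes at most \<open>2^(\<alpha> (k+1))\<close> times the mass
  \<open>C (2 * 2^-k)^s\<close>, that is \<open>C * 2^(\<alpha>+s) * b^k\<close> with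
  \<open>b = 2^(\<alpha>-s)\<close>. As \<open>\<alpha> < s\<close>, the series converges, with a
  sum independent of \<open>x\<close>.\<close>

lemma potential_bounded: "\<exists>M\<ge>0. \<forall>x\<in>ball 0 1. v x \<le> M"
proof -
  define b where "b = 2 powr (\<alpha> - s)"
  have b: "0 < b" "b < 1"
    using s_gt powr_less_mono[of "\<alpha> - s" 0 2] by (auto simp: b_def)
  define M where "M = C * 2 powr (\<alpha> + s) * (1 / (1 - b))"
  have C: "0 \<le> C"
    using order_trans[OF measure_nonneg upper[of 1 0]] by simp
  have half: "(1/2::real)^k = 2 powr (- real k)" for k :: nat
    by (simp add: powr_minus powr_realpow power_one_over inverse_eq_divide)
  have "v x \<le> M" if x: "x \<in> ball 0 1" for x
  proof -
    let ?B = "\<lambda>k::nat. cball x (2 * (1/2)^k) \<inter> sphere 0 1"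
    define a where "a k = 2 powr (\<alpha> * (real k + 1))" for k :: nat
    \<comment> \<open>On the shell where the distance is about \<open>2^-k\<close>, the bound \<open>1 - (norm x)\<^sup>2 \<le> 2 * norm (x - \<xi>)\<close>
      makes the kernel at most \<open>2^(\<alpha> * (k + 1))\<close>.\<close>
    have pt: "ennreal (exp (\<alpha> * ln_poisson x \<xi>)) \<le> (\<Sum>k. ennreal (a k) * indicator (?B k) \<xi>)"
      if \<xi>: "\<xi> \<in> sphere 0 1" for \<xi>
    proof -
      note pos = ball_sphere_pos[OF x \<xi>]
      define \<rho> where "\<rho> = norm (x - \<xi>)"
      have \<rho>: "0 < \<rho>" "\<rho> \<le> 2"
        using pos norm_triangle_ineq4[of x \<xi>] x \<xi> by (auto simp: \<rho>_def)
      obtain k where k: "(1/2)^k < \<rho>" "\<rho> \<le> 2 * (1/2)^k"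
        using dyadic_scale[OF \<rho>] by blast
      have "ln_poisson x \<xi> \<le> ln (2 * \<rho>) - ln (\<rho>\<^sup>2)"
        using one_minus_norm_sqr_le[OF x \<xi>] pos \<rho> by (simp add: ln_poisson_def \<rho>_def)
      also have "\<dots> = ln 2 - ln \<rho>"
        using \<rho> by (simp add: ln_mult ln_realpow)
      also have "\<dots> \<le> ln 2 - ln ((1/2)^k)"
        using \<rho> k by simp
      also have "\<dots> = (real k + 1) * ln 2"
        by (simp add: half ln_powr algebra_simps)
      finally have "\<alpha> * ln_poisson x \<xi> \<le> \<alpha> * ((real k + 1) * ln 2)"
        using \<alpha>_pos by (intro mult_left_mono) auto
      then have "exp (\<alpha> * ln_poisson x \<xi>) \<le> a k"
        by (simp add: a_def powr_def mult.assoc)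
      then have "ennreal (exp (\<alpha> * ln_poisson x \<xi>)) \<le> ennreal (a k) * indicator (?B k) \<xi>"
        using k \<xi> by (simp add: ennreal_leI \<rho>_def dist_norm)
      also have "\<dots> = (\<Sum>j\<in>{k}. ennreal (a j) * indicator (?B j) \<xi>)"
        by (simp only: sum.insert sum.empty finite.emptyI empty_iff not_False_eq_True add_0_right)
      also have "\<dots> \<le> (\<Sum>k. ennreal (a k) * indicator (?B k) \<xi>)"
        by (rule sum_le_suminf) auto
      finally show ?thesis .
    qed
    have "(\<integral>\<^sup>+\<xi>. ennreal (exp (\<alpha> * ln_poisson x \<xi>)) \<partial>\<mu>)
        \<le> (\<integral>\<^sup>+\<xi>. (\<Sum>k. ennreal (a k) * indicator (?B k) \<xi>) \<partial>\<mu>)"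
      by (rule nn_integral_mono) (use pt space_\<mu> in auto)
    also have "\<dots> = (\<Sum>k. ennreal (a k) * emeasure \<mu> (?B k))"
      using closed_inter_sphere_sets
      by (subst nn_integral_suminf) (auto simp: nn_integral_cmult_indicator)
    also have "\<dots> \<le> (\<Sum>k. ennreal (C * 2 powr (\<alpha> + s) * b ^ k))"
    proof (intro suminf_le summableI)
      fix k :: nat
      have "a k * measure \<mu> (?B k) \<le> a k * (C * (2 * (1/2)^k) powr s)"
        by (intro mult_left_mono upper) (auto simp: a_def)
      also have "\<dots> = C * (2 powr (\<alpha> * (real k + 1)) * 2 powr ((1 - real k) * s))"
        by (simp add: a_def half powr_mult powr_powr powr_add[symmetric] algebra_simps)
      also have "\<dots> = C * 2 powr (\<alpha> + s) * b ^ k"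
        by (simp add: b_def powr_add[symmetric] powr_realpow[symmetric] powr_powr algebra_simps
           )
      finally have "a k * measure \<mu> (?B k) \<le> C * 2 powr (\<alpha> + s) * b ^ k" .
      then show "ennreal (a k) * emeasure \<mu> (?B k) \<le> ennreal (C * 2 powr (\<alpha> + s) * b ^ k)"
        by (simp add: emeasure_eq_measure a_def ennreal_mult[symmetric] ennreal_leI)
    qed
    also have "\<dots> = ennreal M"
    proof -
      have "(\<lambda>k. C * 2 powr (\<alpha> + s) * b ^ k) sums M"
        unfolding M_def by (intro sums_mult geometric_sums) (use b in auto)
      then show ?thesis
        using C b by (intro suminf_ennreal_eq) auto
    qed
    finally show ?thesis
      unfolding poisson_potential_def
      by (intro integral_real_bounded) (use C b in \<open>auto simp: M_def\<close>)
  qed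
  moreover have "0 \<le> M" using C b by (simp add: M_def)
  ultimately show ?thesis by blast
qed

text \<open>Almost every pole is at distance at least \<open>\<eta>\<close>, so the kernel is at
  most \<open>((1 - |x|^2) / \<eta>^2)^\<alpha>\<close>; this is the decay of order
  \<open>d^\<alpha>\<close>.\<close>

lemma potential_le_away_from_support:
  assumes x: "x \<in> ball 0 1" and \<eta>: "0 < \<eta>" and far: "\<And>\<zeta>. \<zeta> \<in> closure D \<Longrightarrow> \<eta> \<le> norm (x - \<zeta>)"
  shows "v x \<le> measure \<mu> (space \<mu>) * exp (\<alpha> * (ln (1 - (norm x)\<^sup>2) - ln (\<eta>\<^sup>2)))"
proof -
  have "v x \<le> (\<integral>\<xi>. exp (\<alpha> * (ln (1 - (norm x)\<^sup>2) - ln (\<eta>\<^sup>2))) \<partial>\<mu>)"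
    unfolding poisson_potential_def
  proof (rule integral_mono_AE)
    show "AE \<xi> in \<mu>. exp (\<alpha> * ln_poisson x \<xi>) \<le> exp (\<alpha> * (ln (1 - (norm x)\<^sup>2) - ln (\<eta>\<^sup>2)))"
      using support
    proof eventually_elim
      case (elim \<xi>)
      have "\<eta>\<^sup>2 \<le> (norm (x - \<xi>))\<^sup>2"
        using far[OF elim] \<eta> by (intro power_mono) auto
      then have "ln_poisson x \<xi> \<le> ln (1 - (norm x)\<^sup>2) - ln (\<eta>\<^sup>2)"
        using \<eta> far[OF elim] unfolding ln_poisson_def by (subst diff_left_mono) (auto intro!: ln_mono)
      then show ?case
        using \<alpha>_pos by (simp add: mult_left_mono)
    qed
  qed (use integrable_kernel[OF x] in auto)
  then show ?thesis by (simp add: mult.commute)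
qed

section \<open>Comparison of the potential with the barrier near the sphere\<close>

definition barrier :: "real \<Rightarrow> real^'n \<Rightarrow> real" where
  "barrier A x = exp (\<alpha> * ln_poisson x e) * (A - ln_poisson x e)"

text \<open>Both functions contain the factor \<open>(1 - |x|^2)^\<alpha>\<close>; dividing by it
  leaves \<open>C1 < |x - e|^(-2 \<alpha>) (A - L)\<close>. For \<open>\<xi> = e\<close> the first
  factor blows up while \<open>A - L > A\<close>. For \<open>\<xi> \<noteq> e\<close> the first
  factor is bounded below while \<open>L\<close> tends to minus infinity.\<close>

lemma potential_less_barrier:
  assumes A: "0 < A" and \<xi>: "\<xi> \<in> sphere 0 1" "\<xi> \<notin> closure D"
  shows "\<exists>\<eta>>0. \<forall>x\<in>ball 0 1 \<inter> ball \<xi> \<eta>. ln_poisson x e < 0 \<longrightarrow> v x < barrier A x"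
proof -
  obtain \<eta>0 where \<eta>0: "0 < \<eta>0" "ball \<xi> (2 * \<eta>0) \<inter> closure D = {}"
  proof -
    obtain r where "0 < r" "ball \<xi> r \<subseteq> - closure D"
      using \<xi>(2) openE[of "- closure D" \<xi>] by auto
    then show ?thesis using that[of "r/2"] by auto
  qed
  define C1 where "C1 = measure \<mu> (space \<mu>) * exp (- \<alpha> * ln (\<eta>0\<^sup>2))"
  have C1: "0 \<le> C1" by (simp add: C1_def)
  have red: "v x < barrier A x"
    if x: "x \<in> ball 0 1" "x \<in> ball \<xi> \<eta>0"
      and less: "C1 < exp (- \<alpha> * ln ((norm (x - e))\<^sup>2)) * (A - ln_poisson x e)" for x
  proof -
    have far: "\<eta>0 \<le> norm (x - \<zeta>)" if "\<zeta> \<in> closure D" for \<zeta>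
    proof -
      have "\<not> dist \<xi> \<zeta> < 2 * \<eta>0" using \<eta>0 that by auto
      then show ?thesis
        using x(2) dist_triangle[of \<xi> \<zeta> x] by (simp add: dist_norm)
    qed
    have "v x \<le> exp (\<alpha> * ln (1 - (norm x)\<^sup>2)) * C1"
      using potential_le_away_from_support[OF x(1) \<eta>0(1) far]
      by (simp add: C1_def mult_exp_exp right_diff_distrib mult.left_commute algebra_simps
         )
    also have "\<dots> < exp (\<alpha> * ln (1 - (norm x)\<^sup>2)) *
        (exp (- \<alpha> * ln ((norm (x - e))\<^sup>2)) * (A - ln_poisson x e))"
      using less by (intro mult_strict_left_mono) auto
    also have "\<dots> = barrier A x"
      unfolding barrier_def mult.assoc[symmetric] mult_exp_exp
      by (simp add: ln_poisson_def right_diff_distrib)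
    finally show ?thesis .
  qed
  show ?thesis
  proof (cases "\<xi> = e")
    case True
    \<comment> \<open>Chosen so that \<open>|x - e|^2 \<le> exp T\<close> gives
      \<open>|x - e|^(-2 \<alpha>) \<ge> C1 / A + 1\<close>, whose product with \<open>A\<close>
      exceeds \<open>C1\<close>.\<close>
    define T where "T = - ln (C1 / A + 1) / \<alpha>"
    show ?thesis
    proof (intro exI[of _ "min \<eta>0 (exp (T/2))"] conjI ballI impI)
      fix x assume x: "x \<in> ball 0 1 \<inter> ball \<xi> (min \<eta>0 (exp (T/2)))" and Y: "ln_poisson x e < 0"
      have q: "0 < (norm (x - e))\<^sup>2"
        using ball_sphere_pos(2)[of x e] x e by blast
      have "(norm (x - e))\<^sup>2 \<le> (exp (T/2))\<^sup>2"
        using x True by (intro power_mono) (auto simp: dist_norm norm_minus_commute)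
      also have "\<dots> = exp T" by (simp add: power2_eq_square mult_exp_exp)
      finally have "ln ((norm (x - e))\<^sup>2) \<le> T"
        using q by (metis exp_gt_zero ln_exp ln_le_cancel_iff)
      then have "\<alpha> * ln ((norm (x - e))\<^sup>2) \<le> \<alpha> * T"
        using \<alpha>_pos by (intro mult_left_mono) auto
      also have "\<dots> = - ln (C1 / A + 1)" using \<alpha>_pos by (simp add: T_def)
      finally have "C1 / A + 1 \<le> exp (- \<alpha> * ln ((norm (x - e))\<^sup>2))"
        using C1 A by (subst exp_ln[symmetric]) (auto simp: add_nonneg_pos simp del: exp_ln)
      then have "(C1 / A + 1) * A \<le> exp (- \<alpha> * ln ((norm (x - e))\<^sup>2)) * (A - ln_poisson x e)"
        using A Y C1 by (intro mult_mono) auto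
      then have "C1 < exp (- \<alpha> * ln ((norm (x - e))\<^sup>2)) * (A - ln_poisson x e)"
        using A by (simp add: distrib_right)
      then show "v x < barrier A x"
        using red x by simp
    qed (use \<eta>0 in auto)
  next
    case False
    define d where "d = norm (\<xi> - e)"
    have d: "0 < d" using False by (simp add: d_def)
    \<comment> \<open>Near \<open>\<xi>\<close> one has
      \<open>d^2 / 4 \<le> |x - e|^2 \<le> 4\<close>. Hence \<open>1 - |x|^2 < exp (-T)\<close>
      forces \<open>-L > C1 * 4^\<alpha>\<close>, which compensates the worst factor
      \<open>4^(-\<alpha>)\<close>. The radius \<open>exp (-T) / 2\<close> comes from
      \<open>1 - |x|^2 \<le> 2 |x - \<xi>|\<close>.\<close>
    define T where "T = C1 * exp (\<alpha> * ln 4) - ln (d\<^sup>2 / 4)"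
    show ?thesis
    proof (intro exI[of _ "min \<eta>0 (min (d/2) (exp (- T) / 2))"] conjI ballI impI)
      fix x assume x: "x \<in> ball 0 1 \<inter> ball \<xi> (min \<eta>0 (min (d/2) (exp (- T) / 2)))"
        and Y: "ln_poisson x e < 0"
      then have xb: "x \<in> ball 0 1" by simp
      have q: "0 < (norm (x - e))\<^sup>2" and h: "0 < 1 - (norm x)\<^sup>2"
        using ball_sphere_pos[of x e] xb e by auto
      have x\<xi>: "norm (x - \<xi>) < d / 2" "norm (x - \<xi>) < exp (- T) / 2"
        using x by (auto simp: dist_norm norm_minus_commute)
      have "norm (\<xi> - e) \<le> norm (x - \<xi>) + norm (x - e)"
        using norm_triangle_ineq[of "\<xi> - x" "x - e"] by (simp add: norm_minus_commute)
      then have "(d / 2)\<^sup>2 \<le> (norm (x - e))\<^sup>2"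
        using x\<xi> d by (intro power_mono) (auto simp: d_def)
      then have lnq: "ln (d\<^sup>2 / 4) \<le> ln ((norm (x - e))\<^sup>2)"
        using d q by (intro ln_mono) (auto simp: power_divide)
      have "norm (x - e) \<le> 2"
        using norm_triangle_ineq4[of x e] xb e by simp
      then have "(norm (x - e))\<^sup>2 \<le> 2\<^sup>2"
        by (intro power_mono) auto
      then have "ln ((norm (x - e))\<^sup>2) \<le> ln 4"
        using q by (intro ln_mono) auto
      then have "\<alpha> * ln ((norm (x - e))\<^sup>2) \<le> \<alpha> * ln 4"
        using \<alpha>_pos by (intro mult_left_mono) auto
      then have E: "exp (- \<alpha> * ln 4) \<le> exp (- \<alpha> * ln ((norm (x - e))\<^sup>2))"
        by (simp)
      have "1 - (norm x)\<^sup>2 < exp (- T)"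
        using one_minus_norm_sqr_le[OF xb \<xi>(1)] x\<xi> by simp
      then have "ln (1 - (norm x)\<^sup>2) < - T"
        using h by (metis exp_gt_zero ln_exp ln_less_cancel_iff)
      then have "C1 * exp (\<alpha> * ln 4) < - ln_poisson x e"
        using lnq by (simp add: T_def ln_poisson_def)
      then have "C1 * exp (\<alpha> * ln 4) < A - ln_poisson x e" using A by linarith
      then have "exp (- \<alpha> * ln 4) * (C1 * exp (\<alpha> * ln 4)) < exp (- \<alpha> * ln 4) * (A - ln_poisson x e)"
        by (intro mult_strict_left_mono) auto
      moreover have "exp (- \<alpha> * ln 4) * (C1 * exp (\<alpha> * ln 4)) = C1"
        by (simp add: exp_minus field_simps)
      moreover have "exp (- \<alpha> * ln 4) * (A - ln_poisson x e)
          \<le> exp (- \<alpha> * ln ((norm (x - e))\<^sup>2)) * (A - ln_poisson x e)"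
        using E A Y by (intro mult_right_mono) auto
      ultimately have "C1 < exp (- \<alpha> * ln ((norm (x - e))\<^sup>2)) * (A - ln_poisson x e)" by linarith
      then show "v x < barrier A x"
        using red x by simp
    qed (use \<eta>0 d in auto)
  qed
qed

text \<open>The left side will bound the barrier from above and the right side the potential from
  below, both at depth \<open>r\<close> under a point of \<open>D\<close>. Their quotient has order
  \<open>r^(2 \<alpha> - s) ln (1/r)\<close>, which tends to 0 because
  \<open>s < 2 \<alpha>\<close>.\<close>

lemma eventually_barrier_less:
  assumes "0 < d"
  shows "eventually (\<lambda>r. exp (\<alpha> * (ln (2 * r) - ln d)) * (A - ln r + ln 4)
           < c * r powr s * exp (- \<alpha> * ln (4 * r))) (at_right 0)"
proof -
  define k where "k = 2 * \<alpha> - s"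
  have k: "0 < k" using s_lt by (simp add: k_def)
  have "((\<lambda>r::real. r powr k * (A + ln 4 - ln r)) \<longlongrightarrow> 0) (at_right 0)"
    using k by real_asymp
  moreover have "0 < c * exp (- \<alpha> * ln 4) * exp (- \<alpha> * (ln 2 - ln d))"
    using c_pos by simp
  ultimately have "eventually (\<lambda>r. r powr k * (A + ln 4 - ln r)
      < c * exp (- \<alpha> * ln 4) * exp (- \<alpha> * (ln 2 - ln d))) (at_right 0)"
    by (rule order_tendstoD)
  moreover have "eventually (\<lambda>r::real. 0 < r) (at_right 0)"
    by (rule eventually_at_right_less)
  ultimately show ?thesis
  proof eventually_elim
    case (elim r)
    have "exp (\<alpha> * (ln (2 * r) - ln d)) * (A - ln r + ln 4)
        = exp (\<alpha> * (ln 2 - ln d)) * exp ((s - \<alpha>) * ln r) * (r powr k * (A + ln 4 - ln r))"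
      using elim by (simp add: k_def ln_mult powr_def mult_exp_exp algebra_simps)
    also have "\<dots> < exp (\<alpha> * (ln 2 - ln d)) * exp ((s - \<alpha>) * ln r) *
        (c * exp (- \<alpha> * ln 4) * exp (- \<alpha> * (ln 2 - ln d)))"
      using elim by (intro mult_strict_left_mono) auto
    also have "\<dots> = c * r powr s * exp (- \<alpha> * ln (4 * r))"
      using elim by (simp add: ln_mult powr_def mult_exp_exp algebra_simps)
    finally show ?case .
  qed
qed

text \<open>At depth \<open>r\<close> below \<open>\<xi>\<close>, every pole within \<open>r\<close>
  of \<open>\<xi>\<close> is at distance at most \<open>2 r\<close>, while
  \<open>1 - |x|^2 \<ge> r\<close>. The kernel is therefore at least
  \<open>(r / (2 r)^2)^\<alpha> = (4 r)^(-\<alpha>)\<close> on a set of mass at least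
  \<open>c r^s\<close>.\<close>

lemma potential_ge_at_shifted_point:
  assumes \<xi>: "\<xi> \<in> sphere 0 1" and r: "0 < r" "r < 1"
    and m: "c * r powr s \<le> measure \<mu> (cball \<xi> r \<inter> sphere 0 1)"
  shows "c * r powr s * exp (- \<alpha> * ln (4 * r)) \<le> v ((1 - r) *\<^sub>R \<xi>)"
proof -
  let ?x = "(1 - r) *\<^sub>R \<xi>" and ?B = "cball \<xi> r \<inter> sphere 0 1"
  have nx: "norm ?x = 1 - r" using \<xi> r by simp
  then have x: "?x \<in> ball 0 1" using r by simp
  have h: "r \<le> 1 - (norm ?x)\<^sup>2"
    using r unfolding nx by (simp add: power2_eq_square algebra_simps mult_left_le)
  have pt: "exp (- \<alpha> * ln (4 * r)) * indicator ?B \<zeta> \<le> exp (\<alpha> * ln_poisson ?x \<zeta>)"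
    if \<zeta>: "\<zeta> \<in> sphere 0 1" for \<zeta>
  proof (cases "\<zeta> \<in> ?B")
    case True
    note pos = ball_sphere_pos[OF x \<zeta>]
    have "norm (?x - \<zeta>) \<le> norm (\<xi> - \<zeta>) + norm (r *\<^sub>R \<xi>)"
      using norm_triangle_ineq4[of "\<xi> - \<zeta>" "r *\<^sub>R \<xi>"] by (simp add: algebra_simps)
    also have "\<dots> \<le> 2 * r" using True \<xi> r by (simp add: dist_norm)
    finally have "(norm (?x - \<zeta>))\<^sup>2 \<le> (2 * r)\<^sup>2"
      by (intro power_mono) auto
    then have "ln ((norm (?x - \<zeta>))\<^sup>2) \<le> ln ((2 * r)\<^sup>2)"
      using pos by (intro ln_mono) auto
    moreover have "ln r \<le> ln (1 - (norm ?x)\<^sup>2)"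
      using r h by (intro ln_mono) auto
    moreover have "ln r - ln ((2 * r)\<^sup>2) = - ln (4 * r)"
      using r ln_realpow[of 2 2] by (simp add: ln_mult ln_realpow)
    ultimately have "- ln (4 * r) \<le> ln_poisson ?x \<zeta>"
      by (simp only: ln_poisson_def)
    then have "\<alpha> * - ln (4 * r) \<le> \<alpha> * ln_poisson ?x \<zeta>"
      using \<alpha>_pos by (intro mult_left_mono) auto
    then show ?thesis using True by simp
  qed simp
  have "c * r powr s * exp (- \<alpha> * ln (4 * r)) \<le> exp (- \<alpha> * ln (4 * r)) * measure \<mu> ?B"
    using m by (simp add: mult.commute)
  also have "\<dots> = (\<integral>\<zeta>. exp (- \<alpha> * ln (4 * r)) * indicator ?B \<zeta> \<partial>\<mu>)"
    using closed_inter_sphere_sets[OF closed_cball] space_\<mu> by (simp add: Int_absorb2)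
  also have "\<dots> \<le> v ?x"
    unfolding poisson_potential_def
    by (rule integral_mono)
       (use pt space_\<mu> integrable_kernel[OF x] closed_inter_sphere_sets[OF closed_cball]
         in \<open>auto simp: emeasure_eq_measure\<close>)
  finally show ?thesis .
qed

definition nodal_region :: "real \<Rightarrow> (real^'n) set" where
  "nodal_region A = {x \<in> ball 0 1. ln_poisson x e < 0 \<and> barrier A x < v x}"

lemma support_in_closure_nodal_region:
  assumes A: "0 < A" and \<xi>: "\<xi> \<in> D"
  shows "\<xi> \<in> closure (nodal_region A)"
  unfolding closure_approachable
proof (intro allI impI)
  fix \<epsilon> :: real assume \<epsilon>: "0 < \<epsilon>"
  have \<xi>S: "\<xi> \<in> sphere 0 1" and "\<xi> \<noteq> e" using D e \<xi> closure_subset by blast+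
  define d where "d = (norm (\<xi> - e))\<^sup>2 / 4"
  have ne: "0 < norm (\<xi> - e)" using \<open>\<xi> \<noteq> e\<close> by simp
  then have d: "0 < d" by (simp add: d_def)
  obtain b where b: "0 < b" "\<And>r. 0 < r \<Longrightarrow> r < b \<Longrightarrow>
      exp (\<alpha> * (ln (2 * r) - ln d)) * (A - ln r + ln 4) < c * r powr s * exp (- \<alpha> * ln (4 * r))"
    using eventually_barrier_less[OF d, of A] unfolding eventually_at_right_field by auto
  \<comment> \<open>In this order: the asymptotic comparison applies, the point is
    \<open>\<epsilon>\<close>-close to \<open>\<xi>\<close>, it lies in the ball, it keeps distance
    at least \<open>norm (\<xi> - e) / 2\<close> from \<open>e\<close> (so \<open>d\<close> bounds
    the squared distance below), and \<open>2 r < d\<close> makes \<open>L\<close> negative.\<close>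
  define \<delta> where "\<delta> = Min {b, \<epsilon>, 1, norm (\<xi> - e) / 2, d / 2}"
  have \<delta>: "0 < \<delta>" "\<delta> \<le> b" "\<delta> \<le> \<epsilon>" "\<delta> \<le> 1" "\<delta> \<le> norm (\<xi> - e) / 2" "\<delta> \<le> d / 2"
    using b(1) \<epsilon> d ne by (auto simp: \<delta>_def)
  obtain r where r: "0 < r" "r < \<delta>" "c * r powr s \<le> measure \<mu> (cball \<xi> r \<inter> sphere 0 1)"
    using lower[OF \<xi> \<delta>(1)] by blast
  let ?x = "(1 - r) *\<^sub>R \<xi>"
  have nx: "norm ?x = 1 - r" using \<xi>S r \<delta> by simp
  then have x: "?x \<in> ball 0 1" using r by simp
  note pos = ball_sphere_pos[OF x e(1)]
  have h: "r \<le> 1 - (norm ?x)\<^sup>2" "1 - (norm ?x)\<^sup>2 \<le> 2 * r"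
    using r \<delta> unfolding nx by (simp_all add: power2_eq_square algebra_simps mult_left_le)
  have x\<xi>: "norm (\<xi> - ?x) = r"
  proof -
    have "\<xi> - ?x = r *\<^sub>R \<xi>" by (simp add: algebra_simps)
    then show ?thesis using r \<xi>S by simp
  qed
  have "norm (?x - e) \<le> 2"
    using norm_triangle_ineq4[of ?x e] nx e r by simp
  then have "(norm (?x - e))\<^sup>2 \<le> 2\<^sup>2"
    by (intro power_mono) auto
  then have q4: "ln ((norm (?x - e))\<^sup>2) \<le> ln 4"
    using pos by (intro ln_mono) auto
  have "norm (\<xi> - e) \<le> norm (\<xi> - ?x) + norm (?x - e)"
    using norm_triangle_ineq[of "\<xi> - ?x" "?x - e"] by simp
  then have "(norm (\<xi> - e) / 2)\<^sup>2 \<le> (norm (?x - e))\<^sup>2"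
    using x\<xi> r \<delta> by (intro power_mono) auto
  then have lnd: "ln d \<le> ln ((norm (?x - e))\<^sup>2)"
    using d pos by (intro ln_mono) (auto simp: power_divide d_def)
  have lnh: "ln r \<le> ln (1 - (norm ?x)\<^sup>2)" "ln (1 - (norm ?x)\<^sup>2) \<le> ln (2 * r)"
    using r h pos by (auto intro!: ln_mono)
  have Y: "ln r - ln 4 \<le> ln_poisson ?x e" "ln_poisson ?x e \<le> ln (2 * r) - ln d"
    using lnh lnd q4 by (simp_all only: ln_poisson_def)
  have "ln (2 * r) < ln d"
    using r \<delta> d by (subst ln_less_cancel_iff) auto
  then have Y0: "ln_poisson ?x e < 0" using Y by simp
  have "barrier A ?x \<le> exp (\<alpha> * (ln (2 * r) - ln d)) * (A - ln r + ln 4)"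
    unfolding barrier_def using Y Y0 A \<alpha>_pos by (intro mult_mono) auto
  also have "\<dots> < c * r powr s * exp (- \<alpha> * ln (4 * r))"
    using b(2)[of r] r \<delta> by simp
  also have "\<dots> \<le> v ?x"
    using r \<delta> by (intro potential_ge_at_shifted_point \<xi>S) auto
  finally have "?x \<in> nodal_region A"
    using x Y0 by (simp add: nodal_region_def)
  moreover have "dist ?x \<xi> < \<epsilon>"
    using x\<xi> r \<delta> by (simp add: dist_norm norm_minus_commute)
  ultimately show "\<exists>y\<in>nodal_region A. dist y \<xi> < \<epsilon>" by blast
qed

lemma asymp_boundary_nodal_region:
  assumes A: "0 < A"
  shows "asymp_boundary (nodal_region A) = closure D"
proof
  show "closure D \<subseteq> asymp_boundary (nodal_region A)"
    unfolding asymp_boundary_def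
    using support_in_closure_nodal_region[OF A] D(1)
    by (intro Int_greatest closure_minimal) auto
  show "asymp_boundary (nodal_region A) \<subseteq> closure D"
  proof (rule ccontr)
    assume "\<not> asymp_boundary (nodal_region A) \<subseteq> closure D"
    then obtain \<xi> where \<xi>: "\<xi> \<in> closure (nodal_region A)" "\<xi> \<in> sphere 0 1" "\<xi> \<notin> closure D"
      unfolding asymp_boundary_def by blast
    obtain \<eta> where "0 < \<eta>" and \<eta>: "\<And>x. x \<in> ball 0 1 \<Longrightarrow> x \<in> ball \<xi> \<eta> \<Longrightarrow>
        ln_poisson x e < 0 \<Longrightarrow> v x < barrier A x"
      using potential_less_barrier[OF A \<xi>(2,3)] by blast
    then obtain x where "x \<in> nodal_region A" "dist x \<xi> < \<eta>"
      using \<xi>(1) unfolding closure_approachable by blast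
    then show False
      using \<eta>[of x] by (auto simp: nodal_region_def dist_commute)
  qed
qed

section \<open>The eigenvalue equation for potential and barrier\<close>

lemma potential_jet:
  shows "C2_jet (ball 0 1) v
     (\<lambda>x. \<integral>\<xi>. profile_grad (\<lambda>t. \<alpha> * exp (\<alpha> * t)) x \<xi> \<partial>\<mu>)
     (\<lambda>i x. \<integral>\<xi>. profile_hess (\<lambda>t. \<alpha> * exp (\<alpha> * t)) (\<lambda>t. \<alpha> * (\<alpha> * exp (\<alpha> * t))) i x \<xi> \<partial>\<mu>)"
  unfolding poisson_potential_def[abs_def]
proof (rule C2_jet_integral[OF finite_measure sets_\<mu> compact_sphere open_ball])
  let ?f = "\<lambda>t. exp (\<alpha> * t)"
  have c0: "continuous_on (ball 0 1 \<times> sphere 0 1) (\<lambda>(x::real^'n,y). ?f (ln_poisson x y))"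
    by (intro continuous_on_profile(1)[where f="?f"] continuous_intros) auto
  show "continuous_on (sphere 0 1) (\<lambda>\<xi>. ?f (ln_poisson x \<xi>))" if "x \<in> ball 0 1" for x :: "real^'n"
    using continuous_on_slice[OF c0 that] .
  show "continuous_on (ball 0 1 \<times> sphere 0 1)
      (\<lambda>(x::real^'n,y). profile_grad (\<lambda>t. \<alpha> * exp (\<alpha> * t)) x y)"
    by (intro continuous_on_profile(2)[where f="\<lambda>t. \<alpha> * ?f t"] continuous_intros) auto
  show "continuous_on (ball 0 1 \<times> sphere 0 1) (\<lambda>(x::real^'n,y).
      profile_hess (\<lambda>t. \<alpha> * exp (\<alpha> * t)) (\<lambda>t. \<alpha> * (\<alpha> * exp (\<alpha> * t))) i x y)" for i
    by (intro continuous_on_profile(3) continuous_intros) auto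
  show "C2_jet (ball 0 1) (\<lambda>x::real^'n. ?f (ln_poisson x y))
      (\<lambda>x. profile_grad (\<lambda>t. \<alpha> * exp (\<alpha> * t)) x y)
      (\<lambda>i x. profile_hess (\<lambda>t. \<alpha> * exp (\<alpha> * t)) (\<lambda>t. \<alpha> * (\<alpha> * exp (\<alpha> * t))) i x y)"
    if "y \<in> sphere 0 1" for y
    by (rule C2_jet_profile[OF that]) (auto intro!: derivative_eq_intros continuous_intros)
qed

lemma barrier_jet:
  shows "C2_jet (ball 0 1) (barrier A)
     (\<lambda>x. profile_grad (\<lambda>t. \<alpha> * exp (\<alpha> * t) * (A - t) - exp (\<alpha> * t)) x e)
     (\<lambda>i x. profile_hess (\<lambda>t. \<alpha> * exp (\<alpha> * t) * (A - t) - exp (\<alpha> * t))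
        (\<lambda>t. \<alpha> * \<alpha> * exp (\<alpha> * t) * (A - t) - 2 * \<alpha> * exp (\<alpha> * t)) i x e)"
  unfolding barrier_def[abs_def]
  by (rule C2_jet_profile[OF e(1), where f="\<lambda>t. exp (\<alpha> * t) * (A - t)"])
     (auto intro!: derivative_eq_intros continuous_intros simp: algebra_simps)

text \<open>In jet form the operator moves under the integral, where
  \<open>f = exp (\<alpha> t)\<close> satisfies \<open>f'' - 2 \<alpha> f' = - \<alpha>^2 f\<close>
  for each pole separately.\<close>

lemma hyp_laplacian_potential:
  assumes x: "x \<in> ball 0 1"
  shows "hyp_laplacian v x = - \<alpha>\<^sup>2 * v x"
proof -
  let ?f1 = "\<lambda>t. \<alpha> * exp (\<alpha> * t)" and ?f2 = "\<lambda>t. \<alpha> * (\<alpha> * exp (\<alpha> * t))"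
  have cG: "continuous_on (ball 0 1 \<times> sphere 0 1) (\<lambda>(x::real^'n,y). profile_grad ?f1 x y)"
    by (intro continuous_on_profile(2)[where f="?f1"] continuous_intros) auto
  have cH: "continuous_on (ball 0 1 \<times> sphere 0 1) (\<lambda>(x::real^'n,y). profile_hess ?f1 ?f2 i x y)" for i
    by (intro continuous_on_profile(3) continuous_intros) auto
  note int = integrable_continuous_compact[OF finite_measure sets_\<mu> compact_sphere]
  have intG: "integrable \<mu> (profile_grad ?f1 x)"
    by (rule int[OF continuous_on_slice[OF cG x]])
  have intH: "integrable \<mu> (profile_hess ?f1 ?f2 i x)" for i
    by (rule int[OF continuous_on_slice[OF cH x]])
  have "hyp_laplacian v x = (\<integral>\<xi>. ((1 - (norm x)\<^sup>2) / 2)\<^sup>2 * (\<Sum>i\<in>Basis. profile_hess ?f1 ?f2 i x \<xi> \<bullet> i)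
      + (real CARD('n) - 2) * ((1 - (norm x)\<^sup>2) / 2) * (profile_grad ?f1 x \<xi> \<bullet> x) \<partial>\<mu>)"
    using intG intH by (simp add: hyp_laplacian_jet[OF potential_jet open_ball x])
  also have "\<dots> = (\<integral>\<xi>. - \<alpha>\<^sup>2 * exp (\<alpha> * ln_poisson x \<xi>) \<partial>\<mu>)"
  proof (rule Bochner_Integration.integral_cong[OF refl])
    fix \<xi> assume "\<xi> \<in> space \<mu>"
    then have \<xi>: "\<xi> \<in> sphere 0 1" by (simp add: space_\<mu>)
    have n: "real CARD('n) = 2 * \<alpha> + 1" using \<alpha> by (simp add: field_simps)
    show "((1 - (norm x)\<^sup>2) / 2)\<^sup>2 * (\<Sum>i\<in>Basis. profile_hess ?f1 ?f2 i x \<xi> \<bullet> i)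
      + (real CARD('n) - 2) * ((1 - (norm x)\<^sup>2) / 2) * (profile_grad ?f1 x \<xi> \<bullet> x)
      = - \<alpha>\<^sup>2 * exp (\<alpha> * ln_poisson x \<xi>)"
      using hyp_laplacian_profile[OF x \<xi>, of ?f1 ?f2]
      by (simp add: n power2_eq_square algebra_simps)
  qed
  also have "\<dots> = - \<alpha>\<^sup>2 * v x" by (simp add: poisson_potential_def)
  finally show ?thesis .
qed

lemma hyp_laplacian_barrier:
  assumes x: "x \<in> ball 0 1"
  shows "hyp_laplacian (barrier A) x = - \<alpha>\<^sup>2 * barrier A x"
proof -
  have n: "real CARD('n) = 2 * \<alpha> + 1" using \<alpha> by (simp add: field_simps)
  show ?thesis
    unfolding hyp_laplacian_jet[OF barrier_jet open_ball x]
    using hyp_laplacian_profile[OF x e(1),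
        of "\<lambda>t. \<alpha> * exp (\<alpha> * t) * (A - t) - exp (\<alpha> * t)"
           "\<lambda>t. \<alpha> * \<alpha> * exp (\<alpha> * t) * (A - t) - 2 * \<alpha> * exp (\<alpha> * t)"]
    by (simp add: n barrier_def power2_eq_square algebra_simps)
qed

lemma hyp_laplacian_potential_minus_barrier:
  assumes x: "x \<in> ball 0 1"
  shows "hyp_laplacian (\<lambda>x. v x - barrier A x) x = - \<alpha>\<^sup>2 * (v x - barrier A x)"
proof -
  have "hyp_laplacian (\<lambda>x. v x - barrier A x) x = hyp_laplacian v x - hyp_laplacian (barrier A) x"
    unfolding hyp_laplacian_jet[OF C2_jet_diff[OF potential_jet barrier_jet] open_ball x]
      hyp_laplacian_jet[OF potential_jet open_ball x] hyp_laplacian_jet[OF barrier_jet open_ball x]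
    by (simp add: inner_diff_left sum_subtractf right_diff_distrib)
  then show ?thesis
    by (simp add: hyp_laplacian_potential[OF x] hyp_laplacian_barrier[OF x] right_diff_distrib)
qed

theorem bounded_eigenfunction_exists:
  "\<exists>(\<Omega>::(real^'n) set) (u::real^'n \<Rightarrow> real).
     open \<Omega> \<and> \<Omega> \<subseteq> hyp_space \<and> asymp_boundary \<Omega> = closure D \<and>
     continuous_on (closure \<Omega> \<inter> hyp_space) u \<and> C2_on \<Omega> u \<and>
     bounded (u ` \<Omega>) \<and> (\<exists>x\<in>\<Omega>. u x \<noteq> 0) \<and>
     (\<forall>x\<in>\<Omega>. - hyp_laplacian u x = \<alpha>\<^sup>2 * u x) \<and>
     (\<forall>x\<in>frontier \<Omega> \<inter> hyp_space. u x = 0)"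
proof -
  obtain M where M: "0 \<le> M" "\<And>x. x \<in> ball 0 1 \<Longrightarrow> v x \<le> M"
    using potential_bounded by blast
  \<comment> \<open>On the horosphere \<open>L = 0\<close> the barrier equals \<open>A\<close>,
    which must exceed every value of \<open>v\<close>.\<close>
  define A where "A = M + 1"
  have A: "0 < A" using M by (simp add: A_def)
  let ?u = "\<lambda>x. v x - barrier A x" and ?\<Omega> = "nodal_region A"
  have sub: "?\<Omega> \<subseteq> ball 0 1" by (auto simp: nodal_region_def)
  note jet = C2_jet_diff[OF potential_jet barrier_jet[of A]]
  have cu: "continuous_on (ball 0 1) ?u"
    using jet unfolding C2_jet_def
    by (meson continuous_at_imp_continuous_on has_derivative_continuous)
  have cY: "continuous_on (ball 0 1) (\<lambda>x. ln_poisson x e)"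
    using has_derivative_ln_poisson[OF _ e(1)]
    by (meson continuous_at_imp_continuous_on has_derivative_continuous)
  have op: "open ?\<Omega>"
  proof -
    have "?\<Omega> = (ball 0 1 \<inter> (\<lambda>x. ln_poisson x e) -` {..<0}) \<inter> (ball 0 1 \<inter> ?u -` {0<..})"
      by (auto simp: nodal_region_def)
    also have "open \<dots>"
      by (intro open_Int continuous_open_preimage[OF cu] continuous_open_preimage[OF cY]) auto
    finally show ?thesis .
  qed
  \<comment> \<open>Limits give \<open>L \<le> 0\<close> and \<open>u \<ge> 0\<close>; since
    \<open>x\<close> lies outside the open region, one of the two is an equality. The choice of
    \<open>A\<close> excludes \<open>L = 0\<close>, so \<open>u\<close> vanishes.\<close>
  have zero: "?u x = 0" if x: "x \<in> frontier ?\<Omega>" "x \<in> ball 0 1" for x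
  proof -
    have xc: "x \<in> closure ?\<Omega>" and xn: "x \<notin> ?\<Omega>"
      using x op by (auto simp: frontier_def interior_open)
    obtain X where X: "\<And>k. X k \<in> ?\<Omega>" "X \<longlonglongrightarrow> x"
      using xc closure_sequential by blast
    then have Xb: "\<And>k. X k \<in> ball 0 1" using sub by blast
    have lim: "(\<lambda>k. f (X k)) \<longlonglongrightarrow> f x" if "continuous_on (ball 0 1) f" for f :: "real^'n \<Rightarrow> real"
      using continuous_on_tendsto_compose[OF that X(2) x(2)] Xb by simp
    have Y: "ln_poisson x e \<le> 0"
      by (rule LIMSEQ_le_const2[OF lim[OF cY]])
         (use X in \<open>auto simp: nodal_region_def intro!: less_imp_le\<close>)
    have u: "0 \<le> ?u x"
      by (rule LIMSEQ_le_const[OF lim[OF cu]])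
         (use X in \<open>auto simp: nodal_region_def intro!: less_imp_le\<close>)
    have "ln_poisson x e \<noteq> 0"
    proof
      assume "ln_poisson x e = 0"
      then have "barrier A x = A" by (simp add: barrier_def)
      then show False using u M(2)[OF x(2)] by (simp add: A_def)
    qed
    with Y xn x(2) u show ?thesis by (force simp: nodal_region_def)
  qed
  have bd: "bounded (?u ` ?\<Omega>)"
    unfolding bounded_iff
  proof (intro exI[of _ M] ballI)
    fix y assume "y \<in> ?u ` ?\<Omega>"
    then obtain x where x: "x \<in> ?\<Omega>" "y = ?u x" by blast
    \<comment> \<open>The cut \<open>L < 0 < A\<close> makes the barrier nonnegative, so
      \<open>u\<close> lies between 0 and \<open>v\<close>.\<close>
    then have "0 \<le> barrier A x" "v x \<le> M" "0 < ?u x"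
      using A M by (auto simp: nodal_region_def barrier_def)
    then show "norm y \<le> M" using x by simp
  qed
  obtain \<xi> where "\<xi> \<in> D" using D by blast
  then have "?\<Omega> \<noteq> {}"
    using support_in_closure_nodal_region[OF A] by fastforce
  then have ne: "\<exists>x\<in>?\<Omega>. ?u x \<noteq> 0" by (force simp: nodal_region_def)
  show ?thesis
  proof (intro exI conjI)
    show "asymp_boundary ?\<Omega> = closure D" by (rule asymp_boundary_nodal_region[OF A])
    show "C2_on ?\<Omega> ?u" by (rule C2_on_jet[OF jet open_ball sub])
    show "continuous_on (closure ?\<Omega> \<inter> hyp_space) ?u"
      by (rule continuous_on_subset[OF cu]) auto
    show "\<forall>x\<in>?\<Omega>. - hyp_laplacian ?u x = \<alpha>\<^sup>2 * ?u x"
      using sub by (auto simp: hyp_laplacian_potential_minus_barrier)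
    show "\<forall>x\<in>frontier ?\<Omega> \<inter> hyp_space. ?u x = 0" using zero by blast
  qed (use op sub bd ne in auto)
qed

end

section \<open>Inverse Cantor functions\<close>

text \<open>The \<open>k\<close>-th term jumps by \<open>l^k\<close> at the multiples of \<open>2^-k\<close>. Hence the function is
  increasing, and arguments more than \<open>2^-k\<close> apart have values at least \<open>l^k\<close> apart: its inverse
  is Hoelder continuous, and for \<open>2 * l < 1\<close> its range is dense in a self-similar Cantor set.\<close>

definition cantor_fun :: "real \<Rightarrow> real \<Rightarrow> real" where
  "cantor_fun l t = (\<Sum>k. l^k * of_int \<lfloor>2^k * t\<rfloor>)"

context
  fixes l :: real
  assumes l: "0 < l" "2 * l < 1"
begin

lemma summable_cantor_fun: "summable (\<lambda>k. l^k * of_int \<lfloor>2^k * (t::real)\<rfloor>)"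
proof (rule summable_comparison_test')
  show "summable (\<lambda>k. (2 * l)^k * \<bar>t\<bar> + l^k)"
    using l by (intro summable_add summable_mult2 summable_geometric) auto
  fix k :: nat
  have "\<bar>of_int \<lfloor>2^k * t\<rfloor>\<bar> \<le> \<bar>2^k * t\<bar> + (1::real)" by linarith
  then have "l^k * \<bar>of_int \<lfloor>2^k * t\<rfloor>\<bar> \<le> l^k * (\<bar>2^k * t\<bar> + 1)"
    using l by (intro mult_left_mono) auto
  then show "norm (l^k * of_int \<lfloor>2^k * t\<rfloor>) \<le> (2 * l)^k * \<bar>t\<bar> + l^k"
    using l by (simp add: abs_mult power_mult_distrib algebra_simps)
qed

lemma cantor_fun_diff:
  "cantor_fun l t' - cantor_fun l t = (\<Sum>k. l^k * of_int (\<lfloor>2^k * t'\<rfloor> - \<lfloor>2^k * t\<rfloor>))"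
  "summable (\<lambda>k. l^k * of_int (\<lfloor>2^k * t'\<rfloor> - \<lfloor>2^k * t\<rfloor>))"
  using suminf_diff[OF summable_cantor_fun summable_cantor_fun, of t' t]
    summable_diff[OF summable_cantor_fun summable_cantor_fun, of t' t]
  by (simp_all add: cantor_fun_def right_diff_distrib)

lemma cantor_fun_gap:
  assumes "(1/2)^k < t' - t"
  shows "l^k \<le> cantor_fun l t' - cantor_fun l t"
proof -
  have p: "0 < (1/2::real)^k" by simp
  then have less: "t < t'" using assms by linarith
  then have nn: "0 \<le> l^j * of_int (\<lfloor>2^j * t'\<rfloor> - \<lfloor>2^j * t\<rfloor>)" for j
    using l by (intro mult_nonneg_nonneg) (auto intro!: floor_mono)
  have "1 < 2^k * (t' - t)"
    using assms by (simp add: power_one_over field_simps)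
  then have "1 \<le> \<lfloor>2^k * t'\<rfloor> - \<lfloor>2^k * t\<rfloor>"
    by (simp add: right_diff_distrib) linarith
  then have "l^k * 1 \<le> l^k * of_int (\<lfloor>2^k * t'\<rfloor> - \<lfloor>2^k * t\<rfloor>)"
    using l by (intro mult_left_mono) (simp_all flip: of_int_diff)
  also have "\<dots> \<le> (\<Sum>k. l^k * of_int (\<lfloor>2^k * t'\<rfloor> - \<lfloor>2^k * t\<rfloor>))"
    using sum_le_suminf[OF cantor_fun_diff(2), of "{k}"] nn by simp
  finally show ?thesis by (simp add: cantor_fun_diff(1))
qed

lemma mono_cantor_fun: "mono (cantor_fun l)"
proof
  fix t t' :: real assume "t \<le> t'"
  then have "0 \<le> l^j * of_int (\<lfloor>2^j * t'\<rfloor> - \<lfloor>2^j * t\<rfloor>)" for j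
    using l by (intro mult_nonneg_nonneg) (auto intro!: floor_mono)
  then have "0 \<le> cantor_fun l t' - cantor_fun l t"
    unfolding cantor_fun_diff(1) by (intro suminf_nonneg cantor_fun_diff(2)) auto
  then show "cantor_fun l t \<le> cantor_fun l t'" by simp
qed

text \<open>The terms below \<open>k\<close> cancel. At level \<open>j + k\<close> the floors differ
  by at most \<open>2^j\<close>, so the tail is dominated by \<open>l^k\<close> times the geometric
  series of ratio \<open>2 * l\<close>.\<close>

lemma cantor_fun_same_cell:
  assumes eq: "\<lfloor>2^k * t\<rfloor> = \<lfloor>2^k * t'\<rfloor>"
  shows "\<bar>cantor_fun l t' - cantor_fun l t\<bar> \<le> l^k / (1 - 2 * l)"
proof -
  let ?f = "\<lambda>j. l^j * of_int (\<lfloor>2^j * t'\<rfloor> - \<lfloor>2^j * t\<rfloor>) :: real"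
  \<comment> \<open>The floor at a coarser level is an integer quotient of the floor at level
    \<open>k\<close>, namely \<open>\<lfloor>2^k * u\<rfloor> div 2^(k-j)\<close>.\<close>
  have zero: "?f j = 0" if "j < k" for j
  proof -
    have "2^j * u = (2^k * u) / real_of_int (2^(k-j))" for u :: real
    proof -
      have "(2::real)^k = 2^j * 2^(k-j)"
        using that by (simp add: power_add[symmetric])
      then show ?thesis by simp
    qed
    then have "\<lfloor>2^j * u\<rfloor> = \<lfloor>2^k * u\<rfloor> div 2^(k-j)" for u :: real
      using floor_divide_real_eq_div[of "2^(k-j)" "2^k * u"] by (simp only:) simp
    then show ?thesis using eq by simp
  qed
  have le: "norm (?f (j + k)) \<le> l^k * (2 * l)^j" for j
  proof -
    have "\<bar>2^k * t' - 2^k * t\<bar> < 1" using eq by linarith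
    then have "2^j * \<bar>2^k * t' - 2^k * t\<bar> < 2^j * 1"
      by (intro mult_strict_left_mono) auto
    then have "\<bar>2^j * (2^k * t' - 2^k * t)\<bar> < 2^j" by (simp add: abs_mult)
    then have "\<bar>2^(j+k) * t' - 2^(j+k) * t\<bar> < real_of_int (2^j)"
      by (simp add: power_add algebra_simps)
    then have "\<bar>\<lfloor>2^(j+k) * t'\<rfloor> - \<lfloor>2^(j+k) * t\<rfloor>\<bar> \<le> 2^j" by linarith
    then have "real_of_int \<bar>\<lfloor>2^(j+k) * t'\<rfloor> - \<lfloor>2^(j+k) * t\<rfloor>\<bar> \<le> real_of_int (2^j)"
      by (subst of_int_le_iff)
    then have "\<bar>real_of_int (\<lfloor>2^(j+k) * t'\<rfloor> - \<lfloor>2^(j+k) * t\<rfloor>)\<bar> \<le> 2^j" by simp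
    then have "l^(j+k) * \<bar>real_of_int (\<lfloor>2^(j+k) * t'\<rfloor> - \<lfloor>2^(j+k) * t\<rfloor>)\<bar> \<le> l^(j+k) * 2^j"
      using l by (intro mult_left_mono) auto
    then show ?thesis
      using l by (simp add: abs_mult power_add power_mult_distrib mult_ac)
  qed
  have geo: "(\<lambda>j. l^k * (2 * l)^j) sums (l^k * (1 / (1 - 2 * l)))"
    using l by (intro sums_mult geometric_sums) auto
  have "cantor_fun l t' - cantor_fun l t = (\<Sum>j. ?f (j + k))"
    unfolding cantor_fun_diff(1) suminf_split_initial_segment[OF cantor_fun_diff(2), of _ _ k]
    using sum.neutral[of "{..<k}" ?f] zero by simp
  also have "norm \<dots> \<le> (\<Sum>j. l^k * (2 * l)^j)"
    by (rule norm_suminf_le[OF le]) (use geo in \<open>auto simp: sums_iff\<close>)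
  also have "\<dots> = l^k / (1 - 2 * l)" using geo by (simp add: sums_iff)
  finally show ?thesis by simp
qed

lemma cantor_fun_bounded:
  assumes "0 \<le> t" "t < 1"
  shows "\<bar>cantor_fun l t\<bar> \<le> 1 / (1 - 2 * l)"
proof -
  have "cantor_fun l 0 = 0" by (simp add: cantor_fun_def)
  moreover have "\<lfloor>t\<rfloor> = 0" using assms by linarith
  ultimately show ?thesis
    using cantor_fun_same_cell[of 0 0 t] by simp
qed

end

section \<open>A Cantor set on the sphere\<close>

text \<open>The product of \<open>m\<close> Cantor sets is placed in the hyperplane orthogonal to \<open>e\<close>, scaled by \<open>\<kappa>\<close>
  into the ball of radius 1/2, and lifted to the lower hemisphere. The parameter domain is the cube of
  the whole space; the points do not depend on the coordinate along \<open>e\<close>.\<close>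

locale sphere_cantor =
  fixes e :: "'a::euclidean_space" and s m l \<kappa> :: real
  assumes e: "e \<in> Basis" and m: "m = real DIM('a) - 1" and s: "0 < s" "s < m"
    and l_def: "l = 2 powr (- m / s)" and \<kappa>_def: "\<kappa> = (1 - 2 * l) / (2 * real DIM('a))"
begin

definition plane_point :: "'a \<Rightarrow> 'a" where
  "plane_point t = (\<Sum>i\<in>Basis - {e}. (\<kappa> * cantor_fun l (t \<bullet> i)) *\<^sub>R i)"

definition sphere_point :: "'a \<Rightarrow> 'a" where
  "sphere_point t = plane_point t - sqrt (1 - (norm (plane_point t))\<^sup>2) *\<^sub>R e"

definition cube :: "'a set" where
  "cube = {t. \<forall>i\<in>Basis. 0 \<le> t \<bullet> i \<and> t \<bullet> i < 1}"

text \<open>\<open>l\<close> solves the similarity dimension equation \<open>2^m * l^s = 1\<close>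
  for \<open>2^m\<close> pieces of ratio \<open>l\<close>; the condition \<open>s < m\<close> is
  exactly \<open>l < 1/2\<close>.\<close>

lemma l: "0 < l" "2 * l < 1"
proof -
  show "0 < l" by (simp add: l_def)
  have "2 powr (- m / s) < 2 powr (-1)"
    using s by (intro powr_less_mono) (auto simp: field_simps)
  then show "2 * l < 1" by (simp add: l_def powr_minus)
qed

text \<open>These convert sizes \<open>l^k\<close> on the sphere into parameters:
  \<open>(1/2)^k\<close> is the side of a level-\<open>k\<close> parameter cell, and its power with
  exponent \<open>DIM('a) - 1\<close> is the volume of that cell in the coordinates other than
  \<open>e\<close>.\<close>

lemma l_power_powr: "(l^k) powr (s / m) = (1/2)^k" "(l^k) powr s = ((1/2)^k)^(DIM('a) - 1)"
proof -
  have lk: "l^k = 2 powr (- m / s * real k)"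
    by (simp add: l_def powr_power mult.commute)
  have half: "(1/2::real)^j = 2 powr (- real j)" for j :: nat
    by (simp add: powr_minus powr_realpow power_one_over inverse_eq_divide)
  show "(l^k) powr (s / m) = (1/2)^k"
    using s by (simp add: lk half powr_powr)
  have "((1/2)^k)^(DIM('a) - 1) = (2::real) powr (- real (k * (DIM('a) - 1)))"
    using half[of "k * (DIM('a) - 1)"] by (simp only: power_mult)
  also have "real (k * (DIM('a) - 1)) = real k * m"
    using DIM_positive[where 'a='a] by (simp add: m of_nat_diff Suc_le_eq)
  finally show "(l^k) powr s = ((1/2)^k)^(DIM('a) - 1)"
    using s by (simp add: lk powr_powr mult.commute)
qed

text \<open>\<open>\<kappa>\<close> cancels the geometric series factor and the number of
  coordinates. The remaining 1/2 keeps the set in the ball of radius 1/2 and absorbs the Lipschitz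
  constant 2 of the lift to the sphere.\<close>

lemma \<kappa>: "0 < \<kappa>" "real DIM('a) * (\<kappa> * (x / (1 - 2 * l))) = x / 2"
  using l by (simp_all add: \<kappa>_def)

lemma plane_point_inner:
  assumes "i \<in> Basis"
  shows "plane_point t \<bullet> i = (if i = e then 0 else \<kappa> * cantor_fun l (t \<bullet> i))"
proof -
  have "plane_point t \<bullet> i = (\<Sum>j\<in>Basis - {e}. if j = i then \<kappa> * cantor_fun l (t \<bullet> i) else 0)"
    unfolding plane_point_def inner_sum_left
    by (rule sum.cong) (use assms in \<open>auto simp: inner_Basis\<close>)
  then show ?thesis using assms by (simp add: sum.delta')
qed

text \<open>Applied with \<open>x = 1\<close> to the whole set and with \<open>x = l^k\<close> to a
  level-\<open>k\<close> cell.\<close>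

lemma norm_plane_sum:
  assumes "\<And>i. i \<in> Basis - {e} \<Longrightarrow> \<bar>f i\<bar> \<le> x / (1 - 2 * l)" "0 \<le> x"
  shows "norm (\<Sum>i\<in>Basis - {e}. (\<kappa> * f i) *\<^sub>R i) \<le> x / 2"
proof -
  have "norm (\<Sum>i\<in>Basis - {e}. (\<kappa> * f i) *\<^sub>R i) \<le> real (card (Basis - {e})) * (\<kappa> * (x / (1 - 2 * l)))"
  proof (rule order_trans[OF norm_sum sum_bounded_above])
    fix i assume i: "i \<in> Basis - {e}"
    have "\<kappa> * \<bar>f i\<bar> \<le> \<kappa> * (x / (1 - 2 * l))"
      using \<kappa>(1) assms(1)[OF i] by (intro mult_left_mono) auto
    then show "norm ((\<kappa> * f i) *\<^sub>R i) \<le> \<kappa> * (x / (1 - 2 * l))"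
      using i \<kappa>(1) by (simp add: abs_mult)
  qed
  also have "\<dots> \<le> real DIM('a) * (\<kappa> * (x / (1 - 2 * l)))"
  proof (intro mult_right_mono)
    have "card (Basis - {e}) \<le> DIM('a)" by (rule card_mono) auto
    then show "real (card (Basis - {e})) \<le> real DIM('a)" by simp
    show "0 \<le> \<kappa> * (x / (1 - 2 * l))" using \<kappa>(1) l assms(2) by simp
  qed
  finally show ?thesis by (simp only: \<kappa>(2))
qed

lemma norm_plane_point: "t \<in> cube \<Longrightarrow> norm (plane_point t) \<le> 1 / 2"
  unfolding plane_point_def
  by (rule norm_plane_sum) (auto simp: cube_def intro!: cantor_fun_bounded l)

lemma plane_point_e: "plane_point t \<bullet> e = 0"
  using plane_point_inner[OF e] by simp

lemma norm_plane_point_sqr: "t \<in> cube \<Longrightarrow> (norm (plane_point t))\<^sup>2 \<le> 1 / 4"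
  using power_mono[OF norm_plane_point, of t 2] by (simp add: power_divide)

lemma sphere_point_in_sphere:
  assumes "t \<in> cube" shows "sphere_point t \<in> sphere 0 1"
proof -
  define r where "r = sqrt (1 - (norm (plane_point t))\<^sup>2)"
  have r: "r\<^sup>2 = 1 - (norm (plane_point t))\<^sup>2"
    using norm_plane_point_sqr[OF assms] by (simp add: r_def)
  have "(norm (sphere_point t))\<^sup>2 = plane_point t \<bullet> plane_point t + r\<^sup>2"
  proof -
    have "sphere_point t = plane_point t - r *\<^sub>R e" by (simp add: sphere_point_def r_def)
    moreover have "e \<bullet> plane_point t = 0" using plane_point_e by (simp add: inner_commute)
    ultimately show ?thesis
      unfolding power2_norm_eq_inner using e by (simp add: inner_diff_left inner_diff_right plane_point_e power2_eq_square)
  qed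
  then have "(norm (sphere_point t))\<^sup>2 = 1"
    by (simp add: r power2_norm_eq_inner)
  then show ?thesis using power2_eq_iff_nonneg[of "norm (sphere_point t)" 1] by simp
qed

lemma sphere_point_inner_e: "t \<in> cube \<Longrightarrow> sphere_point t \<bullet> e \<le> 0"
  using norm_plane_point_sqr[of t] e
  by (simp add: sphere_point_def inner_diff_left plane_point_e)

text \<open>The height of the lift is 1-Lipschitz over the ball of radius 1/2: with heights
  \<open>p, q \<ge> 1/2\<close>, \<open>|p - q| \<le> |p - q| (p + q) = |p^2 - q^2| = | |a|^2 -
  |b|^2 | \<le> |a - b| (|a| + |b|) \<le> |a - b|\<close>.\<close>

lemma dist_sphere_point_le:
  assumes "t \<in> cube" "t' \<in> cube"
  shows "dist (sphere_point t) (sphere_point t') \<le> 2 * norm (plane_point t - plane_point t')"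
proof -
  define a b where "a = plane_point t" and "b = plane_point t'"
  have ab: "norm a \<le> 1/2" "norm b \<le> 1/2" "(norm a)\<^sup>2 \<le> 1/4" "(norm b)\<^sup>2 \<le> 1/4"
    using assms norm_plane_point norm_plane_point_sqr by (auto simp: a_def b_def)
  define p q where "p = sqrt (1 - (norm a)\<^sup>2)" and "q = sqrt (1 - (norm b)\<^sup>2)"
  have half: "1/2 \<le> sqrt (1 - x)" if "x \<le> 1/4" for x :: real
    by (rule real_le_rsqrt) (use that in \<open>simp add: power_divide\<close>)
  have pq: "1/2 \<le> p" "1/2 \<le> q" "p\<^sup>2 = 1 - (norm a)\<^sup>2" "q\<^sup>2 = 1 - (norm b)\<^sup>2"
    using ab half by (auto simp: p_def q_def)
  have "\<bar>p - q\<bar> * 1 \<le> \<bar>p - q\<bar> * (p + q)"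
    using pq by (intro mult_left_mono) auto
  also have "\<dots> = \<bar>p\<^sup>2 - q\<^sup>2\<bar>"
    using abs_mult[of "p - q" "p + q"] pq by (simp add: power2_eq_square algebra_simps)
  also have "\<dots> = \<bar>norm a - norm b\<bar> * (norm a + norm b)"
  proof -
    have "p\<^sup>2 - q\<^sup>2 = - ((norm a - norm b) * (norm a + norm b))"
      unfolding pq by (simp add: power2_eq_square algebra_simps)
    then show ?thesis by (simp add: abs_mult)
  qed
  also have "\<dots> \<le> norm (a - b) * 1"
    using ab by (intro mult_mono norm_triangle_ineq3) auto
  finally have "\<bar>p - q\<bar> \<le> norm (a - b)" by simp
  moreover have "dist (sphere_point t) (sphere_point t') = norm ((a - b) - (p - q) *\<^sub>R e)"
    by (simp add: dist_norm sphere_point_def a_def b_def p_def q_def algebra_simps)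
  moreover have "\<dots> \<le> norm (a - b) + \<bar>p - q\<bar>"
    using norm_triangle_ineq4[of "a - b" "(p - q) *\<^sub>R e"] e by simp
  ultimately show ?thesis by (simp add: a_def b_def)
qed

lemma dist_sphere_point_same_cell:
  assumes "t \<in> cube" "t' \<in> cube" "\<And>i. i \<in> Basis - {e} \<Longrightarrow> \<lfloor>2^k * (t \<bullet> i)\<rfloor> = \<lfloor>2^k * (t' \<bullet> i)\<rfloor>"
  shows "dist (sphere_point t) (sphere_point t') \<le> l^k"
proof -
  have "plane_point t - plane_point t'
      = (\<Sum>i\<in>Basis - {e}. (\<kappa> * (cantor_fun l (t \<bullet> i) - cantor_fun l (t' \<bullet> i))) *\<^sub>R i)"
    by (simp add: plane_point_def sum_subtractf[symmetric] right_diff_distrib scaleR_diff_left)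
  also have "norm \<dots> \<le> l^k / 2"
    using assms(3) l by (intro norm_plane_sum cantor_fun_same_cell) auto
  finally show ?thesis
    using dist_sphere_point_le[OF assms(1,2)] by simp
qed

text \<open>Hoelder continuity of the inverse with exponent \<open>s / m\<close>: coordinates more
  than \<open>(1/2)^k\<close> apart have Cantor values at least \<open>l^k\<close> apart, and
  \<open>(l^k) powr (s / m) = (1/2)^k\<close>. The lift changes only the coordinate along
  \<open>e\<close>, so the other coordinates can be compared on the sphere.\<close>

lemma coordinate_dist_le:
  assumes "t \<in> cube" "t' \<in> cube" and i: "i \<in> Basis - {e}"
    and d: "dist (sphere_point t) (sphere_point t') \<le> \<delta>"
  shows "\<bar>t \<bullet> i - t' \<bullet> i\<bar> \<le> 2 * (\<delta> / \<kappa>) powr (s / m)"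
proof (cases "t \<bullet> i = t' \<bullet> i")
  case False
  have "\<bar>t \<bullet> i - t' \<bullet> i\<bar> \<le> 2"
    using assms(1,2) i by (force simp: cube_def abs_le_iff)
  then obtain k where k: "(1/2)^k < \<bar>t \<bullet> i - t' \<bullet> i\<bar>" "\<bar>t \<bullet> i - t' \<bullet> i\<bar> \<le> 2 * (1/2)^k"
    using dyadic_scale[of "\<bar>t \<bullet> i - t' \<bullet> i\<bar>"] False by auto
  have "l^k \<le> \<bar>cantor_fun l (t \<bullet> i) - cantor_fun l (t' \<bullet> i)\<bar>"
  proof (cases "t' \<bullet> i < t \<bullet> i")
    case True
    then show ?thesis using cantor_fun_gap[OF l, of k "t \<bullet> i" "t' \<bullet> i"] k(1) by linarith
  next
    case False
    then show ?thesis using cantor_fun_gap[OF l, of k "t' \<bullet> i" "t \<bullet> i"] k(1) by linarith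
  qed
  then have "\<kappa> * l^k \<le> \<kappa> * \<bar>cantor_fun l (t \<bullet> i) - cantor_fun l (t' \<bullet> i)\<bar>"
    using \<kappa>(1) by (intro mult_left_mono) auto
  also have "\<dots> = \<bar>(sphere_point t - sphere_point t') \<bullet> i\<bar>"
  proof -
    have "e \<bullet> i = 0" using e i by (auto simp: inner_Basis)
    then show ?thesis
      using i \<kappa>(1) by (simp add: sphere_point_def inner_diff_left plane_point_inner abs_mult
          flip: right_diff_distrib)
  qed
  also have "\<dots> \<le> dist (sphere_point t) (sphere_point t')"
    using i by (simp add: dist_norm Basis_le_norm)
  also have "\<dots> \<le> \<delta>" by (rule d)
  finally have "l^k \<le> \<delta> / \<kappa>" using \<kappa>(1) by (simp add: field_simps)
  then have "(l^k) powr (s / m) \<le> (\<delta> / \<kappa>) powr (s / m)"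
    using s l by (intro powr_mono2) auto
  then show ?thesis using k(2) by (simp add: l_power_powr)
qed simp

section \<open>Lebesgue measure of preimages of small sets and of balls\<close>

lemma prod_slab: "(\<Prod>i\<in>Basis. if i = e then 1 else w) = w^(DIM('a) - 1)" for w :: real
proof -
  have "(\<Prod>i\<in>Basis. if i = e then 1 else w) = (\<Prod>i\<in>Basis - {e}. if i = e then 1 else w)"
    using e by (subst prod.remove[of _ e]) auto
  also have "\<dots> = (\<Prod>i\<in>Basis - {e}. w)" by (rule prod.cong) auto
  also have "\<dots> = w^(DIM('a) - 1)" using e by (simp add: card_Diff_singleton)
  finally show ?thesis .
qed

text \<open>Around one preimage \<open>t0\<close>, all preimages lie in a box of side
  \<open>2 * \<rho>\<close> in the \<open>m\<close> free coordinates and side 1 along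
  \<open>e\<close>; its volume is \<open>(4 (\<delta> / \<kappa>)^(s/m))^m\<close>. The set
  \<open>B\<close> is arbitrary and a measurable \<open>Z\<close> encloses its preimage, because
  members of a Hausdorff cover may fail to be measurable.\<close>

lemma preimage_small:
  assumes "0 \<le> \<delta>" and B: "\<And>x y. x \<in> B \<Longrightarrow> y \<in> B \<Longrightarrow> dist x y \<le> \<delta>"
  shows "\<exists>Z\<in>sets lborel. {t\<in>cube. sphere_point t \<in> B} \<subseteq> Z \<and>
           emeasure lborel Z \<le> ennreal (4 powr m / \<kappa> powr s * \<delta> powr s)"
proof (cases "\<exists>t\<in>cube. sphere_point t \<in> B")
  case False
  then show ?thesis by (intro bexI[of _ "{}"]) auto
next
  case True
  then obtain t0 where t0: "t0 \<in> cube" "sphere_point t0 \<in> B" by blast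
  define \<rho> where "\<rho> = 2 * (\<delta> / \<kappa>) powr (s / m)"
  have \<rho>: "0 \<le> \<rho>" by (simp add: \<rho>_def)
  define a b where "a = (\<Sum>i\<in>Basis. (if i = e then 0 else t0 \<bullet> i - \<rho>) *\<^sub>R i)"
    and "b = (\<Sum>i\<in>Basis. (if i = e then 1 else t0 \<bullet> i + \<rho>) *\<^sub>R i)"
  have ab: "a \<bullet> i = (if i = e then 0 else t0 \<bullet> i - \<rho>)" "b \<bullet> i = (if i = e then 1 else t0 \<bullet> i + \<rho>)"
    if "i \<in> Basis" for i
    using that by (simp_all add: a_def b_def)
  have "emeasure lborel (cbox a b) = ennreal (\<Prod>i\<in>Basis. if i = e then 1 else 2 * \<rho>)"
  proof -
    have "(\<Prod>i\<in>Basis. (b - a) \<bullet> i) = (\<Prod>i\<in>Basis. if i = e then 1 else 2 * \<rho>)"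
      by (rule prod.cong) (auto simp: inner_diff_left ab)
    then show ?thesis
      using \<rho> ab by (subst emeasure_lborel_cbox) auto
  qed
  also have "(\<Prod>i\<in>Basis. if i = e then 1 else 2 * \<rho>) = (2 * \<rho>)^(DIM('a) - 1)"
    by (rule prod_slab)
  also have "\<dots> = (2 * \<rho>) powr m"
  proof -
    have "real (DIM('a) - 1) = m"
      using DIM_positive[where 'a='a] by (simp add: m of_nat_diff Suc_le_eq)
    \<comment> \<open>For \<open>\<delta> = 0\<close> the base \<open>2 * \<rho>\<close> is 0, where
      \<open>powr\<close> and the natural power agree only for a nonzero exponent.\<close>
    moreover have "DIM('a) - 1 \<noteq> 0" using s m by auto
    ultimately show ?thesis
      using \<rho> powr_realpow'[of "2 * \<rho>" "DIM('a) - 1"] by simp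
  qed
  also have "\<dots> = 4 powr m / \<kappa> powr s * \<delta> powr s"
    using s assms(1) \<kappa>(1) by (simp add: \<rho>_def powr_mult powr_powr powr_divide)
  finally have "emeasure lborel (cbox a b) = ennreal (4 powr m / \<kappa> powr s * \<delta> powr s)" .
  moreover have "{t\<in>cube. sphere_point t \<in> B} \<subseteq> cbox a b"
  proof
    fix t assume "t \<in> {t\<in>cube. sphere_point t \<in> B}"
    then have t: "t \<in> cube" "sphere_point t \<in> B" by auto
    show "t \<in> cbox a b"
      unfolding mem_box
    proof
      fix i :: 'a assume i: "i \<in> Basis"
      show "a \<bullet> i \<le> t \<bullet> i \<and> t \<bullet> i \<le> b \<bullet> i"
      proof (cases "i = e")
        case True
        then show ?thesis using t i ab by (auto simp: cube_def intro!: less_imp_le)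
      next
        case False
        then have "\<bar>t \<bullet> i - t0 \<bullet> i\<bar> \<le> \<rho>"
          unfolding \<rho>_def using i t t0 B by (intro coordinate_dist_le) auto
        then show ?thesis using False i ab by auto
      qed
    qed
  qed
  ultimately show ?thesis by (intro bexI[of _ "cbox a b"]) auto
qed

text \<open>The witness is the interior of the dyadic cell of \<open>t0\<close> at level
  \<open>k\<close>, with side 1 along \<open>e\<close>: its image has distance at most
  \<open>l^k\<close> from \<open>sphere_point t0\<close>, and its volume is
  \<open>2^(-k m) = (l^k)^s\<close>.\<close>

lemma cell_large:
  assumes t0: "t0 \<in> cube"
  shows "\<exists>Z\<in>sets lborel. Z \<subseteq> {t\<in>cube. sphere_point t \<in> cball (sphere_point t0) (l^k)} \<and>
           emeasure lborel Z = ennreal ((l^k) powr s)"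
proof -
  define n where "n i = of_int \<lfloor>2^k * (t0 \<bullet> i)\<rfloor> * (1/2::real)^k" for i
  define a b where "a = (\<Sum>i\<in>Basis. (if i = e then 0 else n i) *\<^sub>R i)"
    and "b = (\<Sum>i\<in>Basis. (if i = e then 1 else n i + (1/2)^k) *\<^sub>R i)"
  have ab: "a \<bullet> i = (if i = e then 0 else n i)" "b \<bullet> i = (if i = e then 1 else n i + (1/2)^k)"
    if "i \<in> Basis" for i
    using that by (simp_all add: a_def b_def)
  have "emeasure lborel (box a b) = ennreal (\<Prod>i\<in>Basis. if i = e then 1 else (1/2)^k)"
  proof -
    have "(\<Prod>i\<in>Basis. (b - a) \<bullet> i) = (\<Prod>i\<in>Basis. if i = e then 1 else (1/2)^k)"
      by (rule prod.cong) (auto simp: inner_diff_left ab)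
    then show ?thesis
      using ab by (subst emeasure_lborel_box) auto
  qed
  also have "\<dots> = ennreal ((l^k) powr s)"
    by (simp only: prod_slab l_power_powr(2))
  finally have "emeasure lborel (box a b) = ennreal ((l^k) powr s)" .
  moreover have "box a b \<subseteq> {t\<in>cube. sphere_point t \<in> cball (sphere_point t0) (l^k)}"
  proof
    fix t assume "t \<in> box a b"
    then have t: "a \<bullet> i < t \<bullet> i" "t \<bullet> i < b \<bullet> i" if "i \<in> Basis" for i
      using that by (auto simp: mem_box)
    have fl: "\<lfloor>2^k * (t \<bullet> i)\<rfloor> = \<lfloor>2^k * (t0 \<bullet> i)\<rfloor>" if i: "i \<in> Basis - {e}" for i
    proof (rule floor_unique)
      show "of_int \<lfloor>2^k * (t0 \<bullet> i)\<rfloor> \<le> 2^k * (t \<bullet> i)"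
        using t(1)[of i] i ab(1)[of i] by (simp add: n_def power_one_over field_simps)
      show "2^k * (t \<bullet> i) < of_int \<lfloor>2^k * (t0 \<bullet> i)\<rfloor> + 1"
        using t(2)[of i] i ab(2)[of i] by (simp add: n_def power_one_over field_simps)
    qed
    have "t \<in> cube"
      unfolding cube_def
    proof (intro CollectI ballI)
      fix i :: 'a assume i: "i \<in> Basis"
      show "0 \<le> t \<bullet> i \<and> t \<bullet> i < 1"
      proof (cases "i = e")
        case True
        then show ?thesis using t[OF i] ab[OF i] by auto
      next
        case False
        have t0i: "0 \<le> t0 \<bullet> i" "t0 \<bullet> i < 1" using t0 i by (auto simp: cube_def)
        \<comment> \<open>Level-\<open>k\<close> cells subdivide the cube, so membership of
          \<open>t\<close> is decided by the floor it shares with \<open>t0\<close>.\<close>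
        have "0 \<le> \<lfloor>2^k * (t0 \<bullet> i)\<rfloor>" "\<lfloor>2^k * (t0 \<bullet> i)\<rfloor> < 2^k"
          using t0i by (simp_all add: floor_less_iff)
        then have "0 \<le> \<lfloor>2^k * (t \<bullet> i)\<rfloor>" "\<lfloor>2^k * (t \<bullet> i)\<rfloor> < 2^k"
          using fl[of i] i False by simp_all
        then have "0 \<le> 2^k * (t \<bullet> i)" "2^k * (t \<bullet> i) < 2^k"
          by (simp_all only: zero_le_floor floor_less_iff of_int_power of_int_numeral)
        then show ?thesis using zero_less_power[of "2::real" k] by (auto simp: zero_le_mult_iff simp del: zero_less_power)
      qed
    qed
    then show "t \<in> {t\<in>cube. sphere_point t \<in> cball (sphere_point t0) (l^k)}"
      using dist_sphere_point_same_cell[OF t0, of t k] fl by auto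
  qed
  ultimately show ?thesis by (intro bexI[of _ "box a b"]) auto
qed

lemma emeasure_cube: "cube \<in> sets borel" "emeasure lborel cube = 1"
proof -
  have "cube = (\<Inter>i\<in>Basis. {t. 0 \<le> t \<bullet> i} \<inter> {t. t \<bullet> i < 1})"
    by (auto simp: cube_def)
  also have "\<dots> \<in> sets borel"
    by (intro sets.countable_INT'') (auto intro!: countable_finite borel_closed borel_open closed_Collect_le
        open_Collect_less continuous_intros)
  finally show c: "cube \<in> sets borel" .
  have "emeasure lborel cube \<le> emeasure lborel (cbox (0::'a) One)"
    using c by (intro emeasure_mono) (auto simp: cube_def mem_box less_imp_le)
  moreover have "emeasure lborel (box (0::'a) One) \<le> emeasure lborel cube"
    using c by (intro emeasure_mono) (auto simp: cube_def mem_box less_imp_le)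
  ultimately show "emeasure lborel cube = 1"
    by (simp add: emeasure_lborel_cbox_eq emeasure_lborel_box_eq)
qed

section \<open>The image of Lebesgue measure and its densities\<close>

lemma measurable_sphere_point: "sphere_point \<in> borel_measurable borel"
proof -
  have [measurable]: "cantor_fun l \<in> borel_measurable borel"
    using l by (intro borel_measurable_mono mono_cantor_fun)
  have [measurable]: "plane_point \<in> borel_measurable borel"
    unfolding plane_point_def[abs_def] by measurable
  show ?thesis unfolding sphere_point_def[abs_def] by measurable
qed

definition cantor_measure :: "'a measure" where
  "cantor_measure = distr (restrict_space lborel cube) (restrict_space borel (sphere 0 1)) sphere_point"

lemma measurable_sphere_point':
  "sphere_point \<in> measurable (restrict_space lborel cube) (restrict_space borel (sphere 0 1))"
  using measurable_sphere_point sphere_point_in_sphere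
  by (intro measurable_restrict_space2 measurable_restrict_space1)
     (auto simp: space_restrict_space)

lemma sets_cantor_measure: "sets cantor_measure = sets (restrict_space borel (sphere 0 1))"
  by (simp add: cantor_measure_def)

lemma emeasure_cantor_measure:
  assumes "closed A"
  shows "emeasure cantor_measure (A \<inter> sphere 0 1) = emeasure lborel {t\<in>cube. sphere_point t \<in> A}"
    and "{t\<in>cube. sphere_point t \<in> A} \<in> sets lborel"
proof -
  have A: "A \<inter> sphere 0 1 \<in> sets (restrict_space borel (sphere 0 1))"
    using assms by (auto simp: sets_restrict_space)
  have eq: "sphere_point -` (A \<inter> sphere 0 1) \<inter> space (restrict_space lborel cube)
      = {t\<in>cube. sphere_point t \<in> A}"
    using sphere_point_in_sphere by (auto simp: space_restrict_space)
  have "{t\<in>cube. sphere_point t \<in> A} = cube \<inter> (sphere_point -` A \<inter> space borel)" by auto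
  then show *: "{t\<in>cube. sphere_point t \<in> A} \<in> sets lborel"
    using measurable_sets[OF measurable_sphere_point borel_closed[OF assms]] emeasure_cube(1) by auto
  show "emeasure cantor_measure (A \<inter> sphere 0 1) = emeasure lborel {t\<in>cube. sphere_point t \<in> A}"
    unfolding cantor_measure_def emeasure_distr[OF measurable_sphere_point' A] eq
    using emeasure_cube(1) by (intro emeasure_restrict_space) auto
qed

lemma finite_cantor_measure: "finite_measure cantor_measure"
proof
  have "emeasure cantor_measure (space cantor_measure) = emeasure lborel cube"
    using emeasure_cantor_measure(1)[of UNIV]
    by (simp add: cantor_measure_def space_restrict_space)
  then show "emeasure cantor_measure (space cantor_measure) \<noteq> \<infinity>"
    by (simp add: emeasure_cube)
qed

lemma cantor_measure_upper:
  assumes "0 < r"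
  shows "measure cantor_measure (cball x r \<inter> sphere 0 1)
           \<le> 4 powr m / \<kappa> powr s * 2 powr s * r powr s"
proof -
  have "dist y z \<le> 2 * r" if "y \<in> cball x r" "z \<in> cball x r" for y z
    using dist_triangle3[of y z x] that by simp
  then obtain Z where "Z \<in> sets lborel" "{t\<in>cube. sphere_point t \<in> cball x r} \<subseteq> Z"
    "emeasure lborel Z \<le> ennreal (4 powr m / \<kappa> powr s * (2 * r) powr s)"
    using preimage_small[of "2 * r" "cball x r"] assms by auto
  then have "emeasure cantor_measure (cball x r \<inter> sphere 0 1)
      \<le> ennreal (4 powr m / \<kappa> powr s * (2 * r) powr s)"
    unfolding emeasure_cantor_measure(1)[OF closed_cball] by (meson emeasure_mono order_trans)
  then show ?thesis
    using assms by (simp add: finite_measure.emeasure_eq_measure[OF finite_cantor_measure] powr_mult)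
qed

text \<open>The radii are the cell sizes \<open>l^k\<close>. The factor 1 is the density constant
  \<open>c\<close> of \<open>frostman\<close>.\<close>

lemma cantor_measure_lower:
  assumes "\<xi> \<in> sphere_point ` cube" "0 < \<delta>"
  shows "\<exists>r. 0 < r \<and> r < \<delta> \<and> 1 * r powr s \<le> measure cantor_measure (cball \<xi> r \<inter> sphere 0 1)"
proof -
  obtain t0 where t0: "t0 \<in> cube" "\<xi> = sphere_point t0" using assms by blast
  obtain k where k: "l^k < \<delta>"
    using real_arch_pow_inv[OF assms(2), of l] l by auto
  obtain Z where Z: "Z \<in> sets lborel" "Z \<subseteq> {t\<in>cube. sphere_point t \<in> cball \<xi> (l^k)}"
    "emeasure lborel Z = ennreal ((l^k) powr s)"
    using cell_large[OF t0(1), of k] t0(2) by blast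
  have "ennreal ((l^k) powr s) \<le> emeasure cantor_measure (cball \<xi> (l^k) \<inter> sphere 0 1)"
    unfolding Z(3)[symmetric] emeasure_cantor_measure(1)[OF closed_cball]
    by (rule emeasure_mono[OF Z(2) emeasure_cantor_measure(2)]) simp
  then have "(l^k) powr s \<le> measure cantor_measure (cball \<xi> (l^k) \<inter> sphere 0 1)"
    by (simp add: finite_measure.emeasure_eq_measure[OF finite_cantor_measure])
  then show ?thesis using k l by (intro exI[of _ "l^k"]) auto
qed

lemma AE_cantor_measure: "AE \<xi> in cantor_measure. \<xi> \<in> closure (sphere_point ` cube)"
proof -
  have "{\<xi> \<in> space (restrict_space borel (sphere 0 1)). \<xi> \<in> closure (sphere_point ` cube)}
      \<in> sets (restrict_space borel (sphere (0::'a) 1))"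
    by (auto simp: space_restrict_space sets_restrict_space Int_def[symmetric] Int_commute)
  then show ?thesis
    unfolding cantor_measure_def
    by (subst AE_distr_iff[OF measurable_sphere_point'])
       (auto simp: space_restrict_space intro!: AE_I2 subsetD[OF closure_subset])
qed

lemma not_in_closure: "e \<notin> closure (sphere_point ` cube)"
proof -
  have "sphere_point ` cube \<subseteq> {x. e \<bullet> x \<le> 0}"
    using sphere_point_inner_e by (auto simp: inner_commute)
  then have "closure (sphere_point ` cube) \<subseteq> {x. e \<bullet> x \<le> 0}"
    by (rule closure_minimal) (rule closed_halfspace_le)
  then show ?thesis using e by auto
qed

end

section \<open>The Hausdorff dimension of the Cantor set\<close>

lemma hausdorff_pre_le_finite_cover:
  assumes F: "finite F" "A \<subseteq> \<Union>F" "\<And>X. X \<in> F \<Longrightarrow> bounded X \<and> diameter X \<le> \<delta>" and \<delta>: "0 \<le> \<delta>"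
  shows "hausdorff_pre s \<delta> A \<le> (\<Sum>X\<in>F. hd_term s X)"
proof -
  obtain h where h: "bij_betw h {0..<card F} F"
    using ex_bij_betw_nat_finite[OF F(1)] by blast
  \<comment> \<open>Empty sets pad the finite family to a sequence; \<open>hd_term\<close> gives
    them 0 for every exponent, including 0.\<close>
  define C where "C i = (if i < card F then h i else {})" for i
  have hF: "h ` {0..<card F} = F" using h by (simp add: bij_betw_def)
  have "A \<subseteq> (\<Union>i. C i)"
  proof
    fix x assume "x \<in> A"
    then obtain X where "X \<in> F" "x \<in> X" using F(2) by blast
    then have "X \<in> h ` {0..<card F}" unfolding hF by blast
    then obtain i where "i < card F" "h i = X" by auto
    then have "x \<in> C i" using \<open>x \<in> X\<close> by (simp add: C_def)
    then show "x \<in> (\<Union>i. C i)" by blast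
  qed
  moreover have "bounded (C i) \<and> diameter (C i) \<le> \<delta>" for i
  proof (cases "i < card F")
    case True
    then have "h i \<in> F" using hF by auto
    then show ?thesis using F(3) True by (simp add: C_def)
  qed (use \<delta> in \<open>simp add: C_def diameter_empty\<close>)
  ultimately have "hausdorff_pre s \<delta> A \<le> (\<Sum>i. hd_term s (C i))"
    unfolding hausdorff_pre_def
    by (intro INF_lower[where f="\<lambda>C. \<Sum>i. hd_term s (C i)"]) auto
  also have "\<dots> = (\<Sum>i\<in>{0..<card F}. hd_term s (C i))"
    by (rule suminf_finite) (auto simp: C_def hd_term_def)
  also have "\<dots> = (\<Sum>i\<in>{0..<card F}. hd_term s (h i))"
    by (rule sum.cong) (auto simp: C_def)
  also have "\<dots> = (\<Sum>X\<in>F. hd_term s X)"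
    by (rule sum.reindex_bij_betw[OF h])
  finally show ?thesis .
qed

lemma hd_term_le_powr:
  assumes "0 < s" "diameter X \<le> d" "bounded X"
  shows "hd_term s X \<le> ennreal (d powr s)"
  using assms diameter_ge_0[OF assms(3)]
  by (auto simp: hd_term_def intro!: ennreal_leI powr_mono2)

text \<open>For diameters at most 1, lowering the exponent can only increase the term. Exponent 0 is
  separate because \<open>hd_term\<close> then counts each nonempty set as 1, even a point.\<close>

lemma powr_diameter_le_hd_term:
  assumes "0 \<le> t" "t \<le> s" "0 < s" "bounded X" "diameter X \<le> 1"
  shows "ennreal (diameter X powr s) \<le> hd_term t X"
proof -
  have d: "0 \<le> diameter X" using diameter_ge_0[OF assms(4)] .
  consider "X = {}" | "X \<noteq> {}" "t = 0" | "X \<noteq> {}" "t \<noteq> 0" by blast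
  then show ?thesis
  proof cases
    case 2
    have "diameter X powr s \<le> 1 powr s" using d assms by (intro powr_mono2) auto
    then show ?thesis using 2 by (simp add: hd_term_def)
  next
    case 3
    have "diameter X powr s \<le> diameter X powr t" using d assms by (intro powr_mono') auto
    then show ?thesis using 3 by (simp add: hd_term_def ennreal_leI)
  qed (use assms in \<open>simp add: diameter_empty\<close>)
qed

section \<open>Coverings by cells and the mass distribution principle\<close>

context sphere_cantor
begin

text \<open>The index is an extensional function on \<open>Basis - {e}\<close>, so that the indices
  of level \<open>k\<close> lie in a finite \<open>PiE\<close> set whose cardinality is
  known.\<close>

definition cell :: "nat \<Rightarrow> 'a \<Rightarrow> 'a \<Rightarrow> int" where
  "cell k t = (\<lambda>i\<in>Basis - {e}. \<lfloor>2^k * (t \<bullet> i)\<rfloor>)"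

lemma card_cells: "finite (cell k ` cube)" "card (cell k ` cube) \<le> (2^k)^(DIM('a) - 1)"
proof -
  have sub: "cell k ` cube \<subseteq> (Basis - {e}) \<rightarrow>\<^sub>E {0..<2^k}"
  proof (rule image_subsetI)
    fix t assume t: "t \<in> cube"
    have "\<lfloor>2^k * (t \<bullet> i)\<rfloor> \<in> {0..<2^k}" if "i \<in> Basis" for i
      using t that by (auto simp: cube_def floor_less_iff)
    then show "cell k t \<in> (Basis - {e}) \<rightarrow>\<^sub>E {0..<2^k}"
      unfolding cell_def by (intro restrict_PiE_iff[THEN iffD2]) auto
  qed
  have fin: "finite ((Basis - {e}) \<rightarrow>\<^sub>E {0..<2^k::int})"
    by (intro finite_PiE) auto
  show "finite (cell k ` cube)" using finite_subset[OF sub fin] .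
  have "card ((Basis - {e}) \<rightarrow>\<^sub>E {0..<2^k::int}) = (2^k)^(DIM('a) - 1)"
    using e by (simp add: card_PiE card_Diff_singleton nat_power_eq)
  then show "card (cell k ` cube) \<le> (2^k)^(DIM('a) - 1)"
    using card_mono[OF fin sub] by simp
qed

lemma powr_power_swap: "(l^k) powr x = (l powr x)^k"
proof -
  have "(l^k) powr x = (l powr real k) powr x" using l by (simp add: powr_realpow)
  also have "\<dots> = (l powr x) powr real k" by (simp only: powr_powr mult.commute)
  also have "\<dots> = (l powr x)^k" using l by (intro powr_realpow) simp
  finally show ?thesis .
qed

text \<open>At most \<open>2^(k m)\<close> closed cell images, each of diameter at most
  \<open>l^k\<close>, cover the set; as \<open>2^m = l^(-s)\<close>, their sum is at most
  \<open>l^(k (t - s))\<close>. For \<open>t > s\<close> this tends to 0.\<close>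

lemma hausdorff_pre_cantor_le:
  assumes "0 < t" "l^k \<le> \<delta>"
  shows "hausdorff_pre t \<delta> (closure (sphere_point ` cube)) \<le> ennreal ((l powr (t - s))^k)"
proof -
  let ?P = "\<lambda>z. sphere_point ` {t\<in>cube. cell k t = z}"
  define F where "F = (\<lambda>z. closure (?P z)) ` (cell k ` cube)"
  have finF: "finite F" using card_cells(1) by (simp add: F_def)
  have cardF: "card F \<le> (2^k)^(DIM('a) - 1)"
    unfolding F_def using card_image_le[OF card_cells(1)] card_cells(2) order_trans by blast
  have bd: "bounded (?P z) \<and> diameter (?P z) \<le> l^k" for z
  proof
    show "bounded (?P z)"
      using sphere_point_in_sphere by (intro bounded_subset[OF bounded_sphere[of 0 1]]) blast
    show "diameter (?P z) \<le> l^k"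
    proof (rule diameter_le)
      show "?P z \<noteq> {} \<or> 0 \<le> l^k" using l by simp
      fix x y assume "x \<in> ?P z" "y \<in> ?P z"
      then obtain u v where uv: "u \<in> cube" "v \<in> cube" "cell k u = z" "cell k v = z"
        and xy: "x = sphere_point u" "y = sphere_point v" by blast
      have "dist x y \<le> l^k"
        unfolding xy
      proof (rule dist_sphere_point_same_cell[OF uv(1,2)])
        fix i assume "i \<in> Basis - {e}"
        moreover have "cell k u i = cell k v i" using uv(3,4) by simp
        ultimately show "\<lfloor>2^k * (u \<bullet> i)\<rfloor> = \<lfloor>2^k * (v \<bullet> i)\<rfloor>"
          by (simp add: cell_def)
      qed
      then show "norm (x - y) \<le> l^k" by (simp add: dist_norm)
    qed
  qed
  have Fbd: "bounded X \<and> diameter X \<le> l^k" if X: "X \<in> F" for X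
  proof -
    obtain z where "X = closure (?P z)" using X by (auto simp: F_def)
    then show ?thesis using bd[of z] by (simp add: diameter_closure bounded_closure)
  qed
  have cov: "closure (sphere_point ` cube) \<subseteq> \<Union>F"
  proof (rule closure_minimal)
    show "sphere_point ` cube \<subseteq> \<Union>F"
    proof (rule image_subsetI)
      fix t assume t: "t \<in> cube"
      then have "sphere_point t \<in> ?P (cell k t)" by blast
      then have "sphere_point t \<in> closure (?P (cell k t))" by (rule subsetD[OF closure_subset])
      then show "sphere_point t \<in> \<Union>F" unfolding F_def using t by blast
    qed
    have "closed X" if "X \<in> F" for X using that unfolding F_def by blast
    then show "closed (\<Union>F)" using finF by (intro closed_Union) simp_all
  qed
  have "0 < l^k" using l by simp
  then have "0 \<le> \<delta>" using assms(2) by linarith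
  have "hausdorff_pre t \<delta> (closure (sphere_point ` cube)) \<le> (\<Sum>X\<in>F. hd_term t X)"
  proof (rule hausdorff_pre_le_finite_cover[OF finF cov _ \<open>0 \<le> \<delta>\<close>])
    fix X assume "X \<in> F"
    then show "bounded X \<and> diameter X \<le> \<delta>" using Fbd[of X] assms(2) by linarith
  qed
  also have "\<dots> \<le> of_nat (card F) * ennreal ((l^k) powr t)"
    using Fbd by (intro sum_bounded_above hd_term_le_powr[OF assms(1)]) simp_all
  also have "\<dots> = ennreal (real (card F) * (l^k) powr t)"
    by (simp add: ennreal_mult ennreal_of_nat_eq_real_of_nat)
  also have "\<dots> \<le> ennreal ((l powr (t - s))^k)"
  proof (rule ennreal_leI)
    have "real (card F) \<le> real ((2^k)^(DIM('a) - 1))" using cardF by (simp only: of_nat_le_iff)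
    also have "\<dots> = 1 / (l^k) powr s"
      by (simp add: l_power_powr(2) power_one_over)
    finally have "real (card F) * (l^k) powr t \<le> (1 / (l^k) powr s) * (l^k) powr t"
      by (intro mult_right_mono) auto
    also have "\<dots> = (l powr (t - s))^k"
      using l by (simp add: powr_diff power_divide powr_power_swap)
    finally show "real (card F) * (l^k) powr t \<le> (l powr (t - s))^k" .
  qed
  finally show ?thesis .
qed

lemma hausdorff_measure_cantor_zero:
  assumes "s < t"
  shows "hausdorff_measure t (closure (sphere_point ` cube)) = 0"
proof -
  have "hausdorff_pre t \<delta> (closure (sphere_point ` cube)) = 0" if \<delta>: "0 < \<delta>" for \<delta>
  proof -
    define q where "q = l powr (t - s)"
    have q: "0 < q" "q < 1"
      using l assms powr_less_mono'[of l 0 "t - s"] by (auto simp: q_def)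
    obtain k0 where k0: "l^k0 < \<delta>" using real_arch_pow_inv[OF \<delta>, of l] l by auto
    have "(\<lambda>k. ennreal (q^k)) \<longlonglongrightarrow> ennreal 0"
      using q by (intro tendsto_ennrealI LIMSEQ_realpow_zero) auto
    moreover have "\<exists>N. \<forall>k\<ge>N. hausdorff_pre t \<delta> (closure (sphere_point ` cube)) \<le> ennreal (q^k)"
    proof (intro exI[of _ k0] allI impI)
      fix k assume "k0 \<le> k"
      then have "l^k \<le> l^k0" using l by (intro power_decreasing) auto
      then show "hausdorff_pre t \<delta> (closure (sphere_point ` cube)) \<le> ennreal (q^k)"
        unfolding q_def using k0 s assms by (intro hausdorff_pre_cantor_le) auto
    qed
    ultimately have "hausdorff_pre t \<delta> (closure (sphere_point ` cube)) \<le> ennreal 0"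
      by (rule LIMSEQ_le_const)
    then show ?thesis by simp
  qed
  then show ?thesis unfolding hausdorff_measure_def by simp
qed

text \<open>Mass distribution principle: the preimages of any cover fill the unit cube, so
  \<open>1 \<le> c * (sum of diameter^s)\<close>, and diameters at most 1 allow the exponent
  \<open>t \<le> s\<close>. The scale 1 suffices since the measure is a supremum over scales. The
  case \<open>t = s\<close> is included.\<close>

lemma hausdorff_measure_cantor_pos:
  assumes t: "0 \<le> t" "t \<le> s"
  shows "hausdorff_measure t (closure (sphere_point ` cube)) \<noteq> 0"
proof -
  let ?K = "closure (sphere_point ` cube)"
  define c where "c = 4 powr m / \<kappa> powr s"
  have c: "0 < c" using \<kappa>(1) by (simp add: c_def)
  have "ennreal (1 / c) \<le> hausdorff_pre t 1 ?K"
    unfolding hausdorff_pre_def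
  proof (rule INF_greatest)
    fix C :: "nat \<Rightarrow> 'a set"
    assume "C \<in> {C. ?K \<subseteq> (\<Union>i. C i) \<and> (\<forall>i. bounded (C i) \<and> diameter (C i) \<le> 1)}"
    then have cov: "?K \<subseteq> (\<Union>i. C i)" and C: "\<And>i. bounded (C i)" "\<And>i. diameter (C i) \<le> 1"
      by auto
    have "\<exists>Z. Z \<in> sets lborel \<and> {t\<in>cube. sphere_point t \<in> C i} \<subseteq> Z \<and>
        emeasure lborel Z \<le> ennreal (c * diameter (C i) powr s)" for i
      using preimage_small[OF diameter_ge_0[OF C(1)] diameter_bounded_bound[OF C(1)]]
      unfolding c_def Bex_def .
    then have "\<forall>i. \<exists>Z. Z \<in> sets lborel \<and> {t\<in>cube. sphere_point t \<in> C i} \<subseteq> Z \<and>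
        emeasure lborel Z \<le> ennreal (c * diameter (C i) powr s)" ..
    from choice[OF this] obtain Z where
      "\<forall>i. Z i \<in> sets lborel \<and> {t\<in>cube. sphere_point t \<in> C i} \<subseteq> Z i \<and>
        emeasure lborel (Z i) \<le> ennreal (c * diameter (C i) powr s)" ..
    then have Z: "\<And>i. Z i \<in> sets lborel" "\<And>i. {t\<in>cube. sphere_point t \<in> C i} \<subseteq> Z i"
      "\<And>i. emeasure lborel (Z i) \<le> ennreal (c * diameter (C i) powr s)"
      by simp_all
    have "cube \<subseteq> (\<Union>i. Z i)"
    proof
      fix t assume t: "t \<in> cube"
      then have "sphere_point t \<in> ?K" by (intro subsetD[OF closure_subset] imageI)
      then obtain i where "sphere_point t \<in> C i" using cov by blast
      then have "t \<in> {t\<in>cube. sphere_point t \<in> C i}" using t by simp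
      then show "t \<in> (\<Union>i. Z i)" using Z(2)[of i] by blast
    qed
    then have "emeasure lborel cube \<le> emeasure lborel (\<Union>i. Z i)"
      using Z(1) by (intro emeasure_mono) auto
    also have "\<dots> \<le> (\<Sum>i. emeasure lborel (Z i))"
      using Z(1) by (intro emeasure_subadditive_countably) auto
    also have "\<dots> \<le> (\<Sum>i. ennreal c * hd_term t (C i))"
    proof (intro suminf_le summableI)
      fix i
      have "emeasure lborel (Z i) \<le> ennreal c * ennreal (diameter (C i) powr s)"
        using Z(3)[of i] c by (simp add: ennreal_mult)
      also have "\<dots> \<le> ennreal c * hd_term t (C i)"
        using t s C by (intro mult_left_mono powr_diameter_le_hd_term) auto
      finally show "emeasure lborel (Z i) \<le> ennreal c * hd_term t (C i)" .
    qed
    also have "\<dots> = ennreal c * (\<Sum>i. hd_term t (C i))" by simp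
    finally have "ennreal (1 / c) * 1 \<le> ennreal (1 / c) * (ennreal c * (\<Sum>i. hd_term t (C i)))"
      unfolding emeasure_cube(2) by (rule mult_left_mono) (rule zero_le)
    also have "\<dots> = ennreal (1 / c * c) * (\<Sum>i. hd_term t (C i))"
      using c by (subst ennreal_mult) (simp_all add: mult.assoc)
    also have "\<dots> = (\<Sum>i. hd_term t (C i))" using c by simp
    finally show "ennreal (1 / c) \<le> (\<Sum>i. hd_term t (C i))" by simp
  qed
  also have "\<dots> \<le> hausdorff_measure t ?K"
    unfolding hausdorff_measure_def
    by (rule SUP_upper[where f="\<lambda>\<delta>. hausdorff_pre t \<delta> ?K"]) simp
  finally have "ennreal (1 / c) \<le> hausdorff_measure t ?K" .
  moreover have "0 < ennreal (1 / c)" using c by simp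
  ultimately show ?thesis by (metis leD)
qed

lemma hausdorff_dim_cantor: "hausdorff_dim (closure (sphere_point ` cube)) = s"
proof -
  have "(0 \<le> t \<and> hausdorff_measure t (closure (sphere_point ` cube)) = 0) \<longleftrightarrow> s < t" for t
    using hausdorff_measure_cantor_zero[of t] hausdorff_measure_cantor_pos[of t] s(1)
    by (cases "s < t") auto
  then have "{t. 0 \<le> t \<and> hausdorff_measure t (closure (sphere_point ` cube)) = 0} = {s<..}"
    by auto
  then show ?thesis by (simp add: hausdorff_dim_def)
qed

end

section \<open>The main theorem\<close>

theorem mainTheorem13:
  fixes s :: real
  assumes "CARD('n::finite) \<ge> 2"
    and "(real CARD('n) - 1) / 2 < s" and "s < real CARD('n) - 1"
  shows "\<exists>(\<Omega>::(real^'n) set) (u::real^'n \<Rightarrow> real).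
           open \<Omega> \<and> \<Omega> \<subseteq> hyp_space \<and>
           hausdorff_dim (asymp_boundary \<Omega>) = s \<and>
           continuous_on (closure \<Omega> \<inter> hyp_space) u \<and> C2_on \<Omega> u \<and>
           bounded (u ` \<Omega>) \<and> (\<exists>x\<in>\<Omega>. u x \<noteq> 0) \<and>
           (\<forall>x\<in>\<Omega>. - hyp_laplacian u x = ((real CARD('n) - 1)\<^sup>2 / 4) * u x) \<and>
           (\<forall>x\<in>frontier \<Omega> \<inter> hyp_space. u x = 0)"
proof -
  define m where "m = real CARD('n) - 1"
  define l where "l = 2 powr (- m / s)"
  define \<kappa> where "\<kappa> = (1 - 2 * l) / (2 * real CARD('n))"
  obtain e :: "real^'n" where e: "e \<in> Basis" using nonempty_Basis by blast
  interpret S: sphere_cantor e s m l \<kappa>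
    by unfold_locales (use e assms in \<open>auto simp: m_def l_def \<kappa>_def\<close>)
  let ?D = "S.sphere_point ` S.cube"
  have "(0::real^'n) \<in> S.cube" by (simp add: S.cube_def)
  then have D: "?D \<subseteq> sphere 0 1" "?D \<noteq> {}"
    using S.sphere_point_in_sphere by blast+
  \<comment> \<open>The vector \<open>e\<close> is both the normal of the hyperplane carrying the
    planar Cantor set and the pole of the barrier; the set lies on the opposite closed hemisphere.
    With \<open>\<alpha> = m / 2\<close>, the range of \<open>s\<close> is
    \<open>\<alpha> < s < 2 * \<alpha>\<close>.\<close>
  interpret F: frostman S.cantor_measure ?D e "m / 2" s 1 "4 powr m / \<kappa> powr s * 2 powr s"
  proof (rule frostman.intro)
    show "finite_measure S.cantor_measure" by (rule S.finite_cantor_measure)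
    show "sets S.cantor_measure = sets (restrict_space borel (sphere 0 1))"
      by (rule S.sets_cantor_measure)
    show "AE \<xi> in S.cantor_measure. \<xi> \<in> closure ?D" by (rule S.AE_cantor_measure)
    show "e \<notin> closure ?D" by (rule S.not_in_closure)
  qed (use assms e D S.cantor_measure_upper S.cantor_measure_lower in \<open>auto simp: m_def\<close>)
  have "(m / 2)\<^sup>2 = (real CARD('n) - 1)\<^sup>2 / 4" by (simp add: m_def power_divide)
  then show ?thesis
    using F.bounded_eigenfunction_exists S.hausdorff_dim_cantor by metis
qed

end
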